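(* Let $N\in\mathbb N$ and consider the controlled quantum system $\Sigma$ on $N\times N$ density matrices $$\dot\rho(t)=-\mathrm i\Big[H_0+\sum_{j=1}^{r}u_j(t)H_j,\ \rho(t)\Big]-\gamma(t)\,\mathbf{\Gamma}(\rho(t)),\qquad \rho(0)=\rho_0,$$ where $H_0,\dots,H_r\in\mathbb C^{N\times N}$ are traceless hermitian, $H_0$ is diagonal, and $\mathbf{\Gamma}$ is one of the following GKSL operators: either $\mathbf{\Gamma}=\mathbf{\Gamma}_0$ with $N=n$, generated by the single matrix $V=\sigma_+$, or $\mathbf{\Gamma}=\mathbf{\Gamma}_{0,loc}$ with $N=n^m$ ($m,n\in\mathbb N$), generated by the single matrix $V=I_{n^{m-1}}\otimes\sigma_+$, where $\sigma_+=\sum_{k=1}^{n-1}\sqrt{k(n-k)}\,e_ke_{k+1}^T\in\mathbb C^{n\times n}$. Suppose that $\Sigma$ satisfies Assumption UC+S or Assumption FUC, as well as Assumption IN. Then for every $\rho_0\in\mathcal D(N)$, $$\overline{\mathfrak{reach}_\Sigma(\rho_0)}=\mathcal D(N).$$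
   Context: $\mathcal D(N)$ is the set of all $N\times N$ density matrices (positive semidefinite complex matrices of trace $1$); $(e_k)$ is the standard basis; $\otimes$ is the Kronecker product; $\mathfrak{su}(N)$ is the Lie algebra of traceless skew-hermitian $N\times N$ matrices; $\langle\cdot\rangle_{\mathsf{Lie}}$ is the real Lie algebra generated by a set. The GKSL operator generated by a single matrix $V\in\mathbb C^{N\times N}$ is the linear map $\mathbf{\Gamma}(\rho)=\tfrac12(V^\dagger V\rho+\rho V^\dagger V)-V\rho V^\dagger$ on $\mathbb C^{N\times N}$. The control amplitudes $u_j(t)\in\mathbb R$ are piecewise constant and otherwise unrestricted. $\mathfrak{reach}_\Sigma(\rho_0)$ is the set of all $\rho(t)$, $t\ge0$, where $\rho(\cdot)$ runs over the solutions of $\Sigma$ starting at $\rho_0$ under all admissible controls. Assumption UC+S: $\langle \mathrm iH_j : j=0,\dots,r\rangle_{\mathsf{Lie}}=\mathfrak{su}(N)$, and the (piecewise constant) switching function $\gamma(t)\in\{0,1\}$ is available as an additional control. Assumption FUC: $\langle \mathrm iH_j : j=1,\dots,r\rangle_{\mathsf{Lie}}=\mathfrak{su}(N)$ (drift $\mathrm iH_0$ not included), there are no restrictions on the controls $u_j(t)\in\mathbb R$, and $\gamma(t)=\gamma_0$ for all $t\ge0$ with a fixed constant $\gamma_0>0$. Assumption IN: the set of diagonal density matrices $\{\operatorname{diag}(x): x\in\mathbb R^N,\ x_i\ge0,\ \sum_i x_i=1\}$ is invariant under $e^{-t\mathbf{\Gamma}}$ for all $t\ge0$. *)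

theory Defs
  imports "HOL-Analysis.Analysis"
begin

type_synonym 'd cmatrix = "complex^'d^'d"

definition cscale :: "complex \<Rightarrow> 'd cmatrix \<Rightarrow> 'd::finite cmatrix" where
  "cscale c A = (\<chi> i j. c * A $ i $ j)"

definition dagger :: "'d cmatrix \<Rightarrow> 'd::finite cmatrix" where
  "dagger A = (\<chi> i j. cnj (A $ j $ i))"

definition hermitian :: "'d::finite cmatrix \<Rightarrow> bool" where
  "hermitian A \<longleftrightarrow> dagger A = A"

definition diagonal_matrix :: "'d::finite cmatrix \<Rightarrow> bool" where
  "diagonal_matrix A \<longleftrightarrow> (\<forall>i j. i \<noteq> j \<longrightarrow> A $ i $ j = 0)"

definition commutator :: "'d cmatrix \<Rightarrow> 'd cmatrix \<Rightarrow> 'd::finite cmatrix" where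
  "commutator A B = A ** B - B ** A"

definition pos_semidefinite :: "'d::finite cmatrix \<Rightarrow> bool" where
  "pos_semidefinite A \<longleftrightarrow>
     hermitian A \<and> (\<forall>v. 0 \<le> Re (\<Sum>i\<in>UNIV. cnj (v $ i) * (A *v v) $ i))"

definition density_matrices :: "'d::finite cmatrix set" where
  "density_matrices = {\<rho>. pos_semidefinite \<rho> \<and> trace \<rho> = 1}"

definition diag_of :: "real^'d \<Rightarrow> 'd::finite cmatrix" where
  "diag_of x = (\<chi> i j. if i = j then complex_of_real (x $ i) else 0)"

definition diag_density_matrices :: "'d::finite cmatrix set" where
  "diag_density_matrices = {diag_of x | x. (\<forall>i. 0 \<le> x $ i) \<and> (\<Sum>i\<in>UNIV. x $ i) = 1}"

definition su :: "'d::finite cmatrix set" where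
  "su = {A. dagger A = - A \<and> trace A = 0}"

(* subspace refers to real scalars here, so these are the real Lie subalgebras of gl(N,C) *)
definition real_lie_subalgebra :: "'d::finite cmatrix set \<Rightarrow> bool" where
  "real_lie_subalgebra L \<longleftrightarrow> subspace L \<and> (\<forall>A\<in>L. \<forall>B\<in>L. commutator A B \<in> L)"

definition lie_generated :: "'d cmatrix set \<Rightarrow> 'd::finite cmatrix set" where
  "lie_generated S = real_lie_subalgebra hull S"

definition gksl :: "'d cmatrix \<Rightarrow> 'd cmatrix \<Rightarrow> 'd::finite cmatrix" where
  "gksl V \<rho> = (1/2) *\<^sub>R (dagger V ** V ** \<rho> + \<rho> ** dagger V ** V) - V ** \<rho> ** dagger V"

definition superop_exp :: "('d cmatrix \<Rightarrow> 'd cmatrix) \<Rightarrow> 'd cmatrix \<Rightarrow> 'd::finite cmatrix" where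
  "superop_exp L \<rho> = (\<Sum>k. (1 / fact k) *\<^sub>R (L ^^ k) \<rho>)"

(* Concrete matrices are given by their entries, with rows and columns counted from 0.
   A numbering pos of the index type (a bijection onto {..<CARD('d)}) turns such entries
   into a matrix; the standard basis vector e_k is then axis i 1 with pos i = k - 1. *)
type_synonym entries = "nat \<Rightarrow> nat \<Rightarrow> complex"

definition matrix_of_entries :: "('d \<Rightarrow> nat) \<Rightarrow> entries \<Rightarrow> 'd::finite cmatrix" where
  "matrix_of_entries pos M = (\<chi> i j. M (pos i) (pos j))"

(* e_k e_l^T, with k and l counted from 1 *)
definition unit_entries :: "nat \<Rightarrow> nat \<Rightarrow> entries" where
  "unit_entries k l = (\<lambda>a b. if Suc a = k \<and> Suc b = l then 1 else 0)"

definition sigma_plus :: "nat \<Rightarrow> entries" where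
  "sigma_plus n =
     (\<lambda>a b. \<Sum>k=1..n-1. complex_of_real (sqrt (real (k * (n - k)))) * unit_entries k (k + 1) a b)"

definition identity_entries :: "nat \<Rightarrow> entries" where
  "identity_entries p = (\<lambda>a b. if a = b \<and> a < p then 1 else 0)"

(* Kronecker product of A with a q x q matrix B *)
definition kronecker :: "nat \<Rightarrow> entries \<Rightarrow> entries \<Rightarrow> entries" where
  "kronecker q A B = (\<lambda>a b. A (a div q) (b div q) * B (a mod q) (b mod q))"

(* Finitely many switching points in each bounded interval; the values taken at the
   switching points are arbitrary. *)
definition piecewise_constant :: "(real \<Rightarrow> 'a) \<Rightarrow> bool" where
  "piecewise_constant u \<longleftrightarrow>
     (\<forall>T\<ge>0. \<exists>D. finite D \<and>
        (\<forall>s t. 0 \<le> s \<and> s \<le> t \<and> t \<le> T \<and> {s..t} \<inter> D = {} \<longrightarrow> u s = u t))"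

(* The right-hand side at time t; the controls are u j for j = 1, ..., r. *)
definition control_field ::
  "nat \<Rightarrow> (nat \<Rightarrow> 'd cmatrix) \<Rightarrow> ('d cmatrix \<Rightarrow> 'd cmatrix) \<Rightarrow>
   (nat \<Rightarrow> real \<Rightarrow> real) \<Rightarrow> (real \<Rightarrow> real) \<Rightarrow> real \<Rightarrow> 'd cmatrix \<Rightarrow> 'd::finite cmatrix" where
  "control_field r H \<Gamma> u \<gamma> t \<rho> =
     cscale (- \<i>) (commutator (H 0 + (\<Sum>j=1..r. u j t *\<^sub>R H j)) \<rho>) - \<gamma> t *\<^sub>R \<Gamma> \<rho>"

(* A solution is continuous and satisfies the differential equation except at finitely
   many times in each bounded interval, as is appropriate for discontinuous controls. *)
definition is_solution ::
  "(real \<Rightarrow> 'd cmatrix \<Rightarrow> 'd cmatrix) \<Rightarrow> 'd cmatrix \<Rightarrow> (real \<Rightarrow> 'd::finite cmatrix) \<Rightarrow> bool" where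
  "is_solution F \<rho>\<^sub>0 \<rho> \<longleftrightarrow>
     \<rho> 0 = \<rho>\<^sub>0 \<and> continuous_on {0..} \<rho> \<and>
     (\<forall>T\<ge>0. \<exists>D. finite D \<and>
        (\<forall>t. 0 < t \<and> t < T \<and> t \<notin> D \<longrightarrow> (\<rho> has_vector_derivative F t (\<rho> t)) (at t)))"

(* The last component G is the set of admissible switching functions. *)
definition reach ::
  "nat \<Rightarrow> (nat \<Rightarrow> 'd cmatrix) \<Rightarrow> ('d cmatrix \<Rightarrow> 'd cmatrix) \<Rightarrow> (real \<Rightarrow> real) set \<Rightarrow>
   'd cmatrix \<Rightarrow> 'd::finite cmatrix set" where
  "reach r H \<Gamma> G \<rho>\<^sub>0 =
     {\<rho> t | \<rho> t u \<gamma>. 0 \<le> t \<and> (\<forall>j\<in>{1..r}. piecewise_constant (u j)) \<and> \<gamma> \<in> G \<and>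
        is_solution (control_field r H \<Gamma> u \<gamma>) \<rho>\<^sub>0 \<rho>}"

definition assumption_UCS ::
  "nat \<Rightarrow> (nat \<Rightarrow> 'd::finite cmatrix) \<Rightarrow> (real \<Rightarrow> real) set \<Rightarrow> bool" where
  "assumption_UCS r H G \<longleftrightarrow>
     lie_generated ((\<lambda>j. cscale \<i> (H j)) ` {0..r}) = su \<and>
     G = {\<gamma>. piecewise_constant \<gamma> \<and> (\<forall>t\<ge>0. \<gamma> t \<in> {0, 1})}"

definition assumption_FUC ::
  "nat \<Rightarrow> (nat \<Rightarrow> 'd::finite cmatrix) \<Rightarrow> (real \<Rightarrow> real) set \<Rightarrow> bool" where
  "assumption_FUC r H G \<longleftrightarrow>
     lie_generated ((\<lambda>j. cscale \<i> (H j)) ` {1..r}) = su \<and>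
     (\<exists>\<gamma>\<^sub>0>0. G = {\<gamma>. \<forall>t\<ge>0. \<gamma> t = \<gamma>\<^sub>0})"

definition assumption_IN :: "('d::finite cmatrix \<Rightarrow> 'd cmatrix) \<Rightarrow> bool" where
  "assumption_IN \<Gamma> \<longleftrightarrow>
     (\<forall>t\<ge>0. \<forall>\<rho>\<in>diag_density_matrices.
        superop_exp (\<lambda>X. (- t) *\<^sub>R \<Gamma> X) \<rho> \<in> diag_density_matrices)"

definition gksl_\<Gamma>\<^sub>0 :: "('d::finite \<Rightarrow> nat) \<Rightarrow> ('d cmatrix \<Rightarrow> 'd cmatrix) \<Rightarrow> bool" where
  "gksl_\<Gamma>\<^sub>0 pos \<Gamma> \<longleftrightarrow>
     (\<exists>n. CARD('d) = n \<and> \<Gamma> = gksl (matrix_of_entries pos (sigma_plus n)))"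

definition gksl_\<Gamma>\<^sub>0_loc :: "('d::finite \<Rightarrow> nat) \<Rightarrow> ('d cmatrix \<Rightarrow> 'd cmatrix) \<Rightarrow> bool" where
  "gksl_\<Gamma>\<^sub>0_loc pos \<Gamma> \<longleftrightarrow>
     (\<exists>n m. 1 \<le> n \<and> 1 \<le> m \<and> CARD('d) = n ^ m \<and>
        \<Gamma> = gksl (matrix_of_entries pos
                   (kronecker n (identity_entries (n ^ (m - 1))) (sigma_plus n))))"

end

theory Submission
  imports Defs
begin

text \<open>
  Let \<open>C\<close> be the closure of the reachable set. The superoperators that map \<open>C\<close> into itself form a
  closed monoid \<open>S\<close>, and \<open>{X. \<forall>t. exp (t X) \<in> S}\<close> is a real Lie algebra by the product formula.
  It contains \<open>ad (\<i> H\<^sub>j)\<close>: when the noise can be switched off because one-parameter groups of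
  isometries are recurrent, and when it cannot because strong short pulses dominate the drift. Hence
  \<open>C\<close> is invariant under all unitary conjugations, and also under the semigroup of \<open>- \<i> [H\<^sub>0, \<cdot>] - v \<Gamma>\<close>.

  On diagonal states this semigroup moves population down the ladder of basis states. A minimizer over
  \<open>C\<close> of the energy \<open>\<Sum>\<^sub>i pos(i) \<rho>\<^sub>i\<^sub>i\<close> is diagonal with sorted populations, and it has no population that
  can still decay, so it is the ground state. Conversely, running the decay backwards from a
  diagonal state whose support is an initial segment makes one population vanish in finite time; by
  induction every diagonal state can be reached from the ground state. Finally, among the states at
  the same distance from \<open>C\<close> as a given state there is a diagonal one, namely a minimizer of the
  energy, so that distance is \<open>0\<close>.
\<close>

section \<open>The Banach algebra of endomorphisms of a Euclidean space\<close>

text \<open>The dissipator runs forward in time only, so only the coherent part can be made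
  invertible: the Lie algebra consists of two-sided one-parameter groups, while dissipation enters
  just through its forward semigroup. Working with superoperators that preserve the closure, instead
  of composing controls explicitly, allows limits at every stage; this matters most under FUC, where
  the noise never stops. The local operator, identity tensor \<open>sigma_plus\<close>, is again a
  ladder on all N levels, but its coefficients vanish at multiples of n, so decay alone gets stuck
  at the bottom of every block. Permutations of the levels overcome this: what counts is that the
  transition from level 1 to level 0 has a nonzero coefficient. Starting from a state with level 1
  occupied and no gap below its highest occupied level, the backward decay must leave the set of
  states, and the first vanishing population marks a state with smaller support. The target is thus
  the forward image, after a finite time, of a simpler state; no limit is taken in that
  induction.\<close>

typedef (overloaded) 'a endo = "UNIV :: ('a::euclidean_space \<Rightarrow>\<^sub>L 'a) set"
  morphisms blinfun_of_endo endo_of_blinfun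
  by simp

setup_lifting type_definition_endo

instantiation endo :: (euclidean_space) real_normed_vector
begin

lift_definition zero_endo :: "'a endo" is 0 .
lift_definition plus_endo :: "'a endo \<Rightarrow> 'a endo \<Rightarrow> 'a endo" is "(+)" .
lift_definition minus_endo :: "'a endo \<Rightarrow> 'a endo \<Rightarrow> 'a endo" is "(-)" .
lift_definition uminus_endo :: "'a endo \<Rightarrow> 'a endo" is uminus .
lift_definition scaleR_endo :: "real \<Rightarrow> 'a endo \<Rightarrow> 'a endo" is "(*\<^sub>R)" .
lift_definition norm_endo :: "'a endo \<Rightarrow> real" is norm .

definition dist_endo :: "'a endo \<Rightarrow> 'a endo \<Rightarrow> real" where
  "dist_endo a b = norm (a - b)"
definition sgn_endo :: "'a endo \<Rightarrow> 'a endo" where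
  "sgn_endo x = scaleR (inverse (norm x)) x"
definition uniformity_endo :: "('a endo \<times> 'a endo) filter" where
  "uniformity_endo = (INF e\<in>{0<..}. principal {(x, y). dist x y < e})"
definition open_endo :: "'a endo set \<Rightarrow> bool" where
  "open_endo U = (\<forall>x\<in>U. eventually (\<lambda>(x', y). x' = x \<longrightarrow> y \<in> U) uniformity)"

instance
proof
  show "norm (x + y) \<le> norm x + norm y" for x y :: "'a endo"
    by transfer (rule norm_triangle_ineq)
qed (unfold dist_endo_def sgn_endo_def uniformity_endo_def open_endo_def,
     (rule refl | (transfer, simp add: algebra_simps))+)

end

text \<open>A type of its own makes composition the multiplication, so that \<open>exp\<close>,
  powers and the norm estimates of Banach algebras apply to superoperators verbatim.\<close>

instantiation endo :: (euclidean_space) real_normed_algebra_1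
begin

lift_definition one_endo :: "'a endo" is id_blinfun .
lift_definition times_endo :: "'a endo \<Rightarrow> 'a endo \<Rightarrow> 'a endo" is "(o\<^sub>L)" .

instance
proof
  fix a b c :: "'a endo" and r :: real
  show "a * b * c = a * (b * c)" by transfer (auto intro: blinfun_eqI)
  show "1 * a = a" by transfer (auto intro: blinfun_eqI)
  show "a * 1 = a" by transfer (auto intro: blinfun_eqI)
  show "(a + b) * c = a * c + b * c"
    by transfer (auto intro!: blinfun_eqI simp: blinfun.add_left)
  show "a * (b + c) = a * b + a * c"
    by transfer (auto intro!: blinfun_eqI simp: blinfun.add_left blinfun.add_right)
  show "(r *\<^sub>R a) * b = r *\<^sub>R (a * b)"
    by transfer (auto intro!: blinfun_eqI simp: blinfun.scaleR_left)
  show "a * (r *\<^sub>R b) = r *\<^sub>R (a * b)"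
    by transfer (auto intro!: blinfun_eqI simp: blinfun.scaleR_left blinfun.scaleR_right)
  show "norm (a * b) \<le> norm a * norm b" by transfer (rule norm_blinfun_compose)
  show "norm (1 :: 'a endo) = 1" by transfer (rule norm_blinfun_id)
  show "(0 :: 'a endo) \<noteq> 1"
    by transfer (metis norm_blinfun_id norm_zero zero_neq_one)
qed

end

lemma bounded_linear_blinfun_of_endo: "bounded_linear blinfun_of_endo"
  by (rule bounded_linear_intro[where K = 1])
     (simp_all add: plus_endo.rep_eq scaleR_endo.rep_eq norm_endo.rep_eq)

lemma bounded_linear_endo_of_blinfun: "bounded_linear endo_of_blinfun"
  by (rule bounded_linear_intro[where K = 1])
     (simp_all add: plus_endo_def scaleR_endo_def norm_endo_def endo_of_blinfun_inverse)

instance endo :: (euclidean_space) banach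
proof
  fix X :: "nat \<Rightarrow> 'a endo"
  assume "Cauchy X"
  then have "Cauchy (\<lambda>n. blinfun_of_endo (X n))"
    by (rule bounded_linear.Cauchy[OF bounded_linear_blinfun_of_endo])
  then obtain l where "(\<lambda>n. blinfun_of_endo (X n)) \<longlonglongrightarrow> l"
    using Cauchy_convergent_iff convergent_def by blast
  then have "X \<longlonglongrightarrow> endo_of_blinfun l"
    using bounded_linear.tendsto[OF bounded_linear_endo_of_blinfun]
    by (fastforce simp: blinfun_of_endo_inverse)
  then show "convergent X" by (auto simp: convergent_def)
qed

text \<open>Finite dimension enters here: bounded orbits of superoperators have convergent
  subsequences, the source of recurrence in \<open>exp_mem_of_bounded_orbit\<close>.\<close>

instance endo :: (euclidean_space) heine_borel
proof
  fix f :: "nat \<Rightarrow> 'a endo"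
  assume "bounded (range f)"
  then have "bounded (range (\<lambda>n. blinfun_of_endo (f n)))"
    using bounded_linear_image[OF _ bounded_linear_blinfun_of_endo, of "range f"]
    by (simp add: image_image)
  then obtain l r where "strict_mono r" "((\<lambda>n. blinfun_of_endo (f n)) \<circ> r) \<longlonglongrightarrow> l"
    using bounded_imp_convergent_subsequence by blast
  then have "(f \<circ> r) \<longlonglongrightarrow> endo_of_blinfun l"
    using bounded_linear.tendsto[OF bounded_linear_endo_of_blinfun]
    by (fastforce simp: blinfun_of_endo_inverse o_def)
  then show "\<exists>l r. strict_mono r \<and> (f \<circ> r) \<longlonglongrightarrow> l"
    using \<open>strict_mono r\<close> by blast
qed

lift_definition endo_apply :: "'a endo \<Rightarrow> 'a::euclidean_space \<Rightarrow> 'a" is blinfun_apply .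

lift_definition endo_of :: "('a::euclidean_space \<Rightarrow> 'a) \<Rightarrow> 'a endo" is Blinfun .

lemma endo_apply_endo_of: "linear f \<Longrightarrow> endo_apply (endo_of f) = f"
  by transfer (simp add: bounded_linear_Blinfun_apply linear_conv_bounded_linear)

lemma endo_eqI: "(\<And>x. endo_apply S x = endo_apply T x) \<Longrightarrow> S = T"
  by transfer (rule blinfun_eqI)

lemma bounded_bilinear_endo_apply: "bounded_bilinear endo_apply"
proof
  show "\<exists>K. \<forall>T (x::'a). norm (endo_apply T x) \<le> norm T * norm x * K"
    by (rule exI[of _ 1], transfer) (simp add: norm_blinfun)
qed (transfer, simp add: blinfun.bilinear_simps)+

interpretation endo: bounded_bilinear endo_apply
  by (rule bounded_bilinear_endo_apply)

lemma endo_apply_1 [simp]: "endo_apply 1 x = x"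
  by transfer simp

lemma endo_apply_times [simp]: "endo_apply (S * T) x = endo_apply S (endo_apply T x)"
  by transfer simp

lemma closed_endo_stable: "closed C \<Longrightarrow> closed {T. \<forall>x\<in>C. endo_apply T x \<in> C}"
proof -
  assume "closed C"
  then have "closed ((\<lambda>T. endo_apply T x) -` C)" for x
    by (intro closed_vimage continuous_intros) (auto intro: endo.continuous_on)
  moreover have "{T. \<forall>x\<in>C. endo_apply T x \<in> C} = (\<Inter>x\<in>C. (\<lambda>T. endo_apply T x) -` C)"
    by auto
  ultimately show ?thesis by auto
qed

section \<open>Generators of closed semigroups\<close>

text \<open>Telescoping: an n-step error is controlled by n one-step errors. It is meant for
  \<open>m\<close> of size 1 + M/n or exp (M/n), for which \<open>m ^ n\<close> stays
  bounded.\<close>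

lemma norm_power_diff_le:
  fixes a b :: "'a::real_normed_algebra_1"
  assumes "norm a \<le> m" "norm b \<le> m" "1 \<le> m"
  shows "norm (a ^ n - b ^ n) \<le> of_nat n * m ^ n * norm (a - b)"
proof (induction n)
  case (Suc n)
  have b: "norm (b ^ n) \<le> m ^ n"
    by (meson assms(2) norm_ge_zero norm_power_ineq order_trans power_mono)
  have "a ^ Suc n - b ^ Suc n = a * (a ^ n - b ^ n) + (a - b) * b ^ n"
    by (simp add: algebra_simps)
  also have "norm \<dots> \<le> norm a * norm (a ^ n - b ^ n) + norm (a - b) * norm (b ^ n)"
    by (meson add_mono norm_mult_ineq norm_triangle_ineq order_trans)
  also have "\<dots> \<le> m * (of_nat n * m ^ n * norm (a - b)) + norm (a - b) * m ^ n"
    using assms Suc b by (intro add_mono mult_mono) auto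
  also have "norm (a - b) * m ^ n \<le> norm (a - b) * m ^ Suc n"
    using assms by (intro mult_left_mono power_increasing) auto
  finally show ?case by (simp add: algebra_simps)
qed simp

lemma exp_of_nat_scaleR:
  fixes X :: "'a::{real_normed_algebra_1,banach}"
  shows "exp (of_nat n *\<^sub>R X) = exp X ^ n"
proof (induction n)
  case (Suc n)
  have "exp (of_nat (Suc n) *\<^sub>R X) = exp (X + of_nat n *\<^sub>R X)"
    by (simp add: algebra_simps)
  also have "\<dots> = exp X * exp (of_nat n *\<^sub>R X)"
    by (rule exp_add_commuting) simp
  finally show ?case using Suc by simp
qed simp

lemma exp_scaleR_add:
  fixes X :: "'a::{real_normed_algebra_1,banach}"
  shows "exp ((s + t) *\<^sub>R X) = exp (s *\<^sub>R X) * exp (t *\<^sub>R X)"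
  by (simp add: scaleR_left_distrib exp_add_commuting)

lemma exp_scaleR_minus_inverse:
  fixes X :: "'a::{real_normed_algebra_1,banach}"
  shows "exp (t *\<^sub>R X) * exp ((- t) *\<^sub>R X) = 1" "exp ((- t) *\<^sub>R X) * exp (t *\<^sub>R X) = 1"
  using exp_scaleR_add[of t "- t" X] exp_scaleR_add[of "- t" t X] by auto

lemma exp_scaleR_has_vector_derivative_0:
  fixes X :: "'a::{real_normed_algebra_1,banach}"
  shows "((\<lambda>t. exp (t *\<^sub>R X)) has_vector_derivative X) (at 0 within S)"
  using exp_scaleR_has_vector_derivative_left[of X 0]
  by (auto intro: has_vector_derivative_at_within)

lemma has_vector_derivative_imp_quotient_tendsto:
  assumes "(f has_vector_derivative D) (at x within S)"
  shows "((\<lambda>y. (f y - f x) /\<^sub>R (y - x)) \<longlongrightarrow> D) (at x within S)"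
proof -
  have "((\<lambda>y. norm (f y - f x - (y - x) *\<^sub>R D) / norm (y - x)) \<longlongrightarrow> 0) (at x within S)"
    using assms by (simp add: has_vector_derivative_def has_derivative_iff_norm)
  moreover have "norm (f y - f x - (y - x) *\<^sub>R D) / norm (y - x)
      = norm ((f y - f x) /\<^sub>R (y - x) - D)" if "y \<noteq> x" for y
  proof -
    have "(f y - f x) /\<^sub>R (y - x) - D = (f y - f x - (y - x) *\<^sub>R D) /\<^sub>R (y - x)"
      using that by (simp add: scaleR_right_diff_distrib)
    then show ?thesis by (simp add: divide_inverse_commute)
  qed
  ultimately have "((\<lambda>y. norm ((f y - f x) /\<^sub>R (y - x) - D)) \<longlongrightarrow> 0) (at x within S)"
    by (simp cong: Lim_cong_within)
  then show ?thesis by (simp add: tendsto_norm_zero_iff LIM_zero_iff)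
qed

text \<open>Near 0 the curve \<open>F\<close> and the group exp (h X) agree up to o(h), and at h =
  1/n both have norm at most exp (m/n); n errors of size o(1/n) add up to o(1). \<open>F\<close>
  need not be a semigroup, so products of exponentials and Euler steps are both admissible.\<close>

lemma chernoff:
  fixes F :: "real \<Rightarrow> 'a::{real_normed_algebra_1,banach}"
  assumes F0: "F 0 = 1" and F: "(F has_vector_derivative X) (at 0 within {0..})"
  shows "(\<lambda>n. F (1 / of_nat n) ^ n) \<longlonglongrightarrow> exp X"
proof -
  have lim: "(\<lambda>n. of_nat n *\<^sub>R (F' (1 / of_nat n) - 1)) \<longlonglongrightarrow> X"
    if "F' 0 = 1" "(F' has_vector_derivative X) (at 0 within {0..})" for F' :: "real \<Rightarrow> 'a"
  proof -
    have "((\<lambda>h. (F' h - 1) /\<^sub>R h) \<longlongrightarrow> X) (at 0 within {0..})"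
      using has_vector_derivative_imp_quotient_tendsto[OF that(2)] that(1) by simp
    moreover have "filterlim (\<lambda>n. 1 / of_nat n) (at (0::real) within {0..}) sequentially"
      by (auto simp: filterlim_at lim_1_over_n eventually_sequentially intro!: exI[of _ 1])
    ultimately have "(\<lambda>n. (F' (1 / of_nat n) - 1) /\<^sub>R (1 / of_nat n)) \<longlonglongrightarrow> X"
      by (rule filterlim_compose)
    then show ?thesis by simp
  qed
  define G where "G h = exp (h *\<^sub>R X)" for h
  have limF: "(\<lambda>n. of_nat n *\<^sub>R (F (1 / of_nat n) - 1)) \<longlonglongrightarrow> X"
    using lim[OF F0 F] .
  have limG: "(\<lambda>n. of_nat n *\<^sub>R (G (1 / of_nat n) - 1)) \<longlonglongrightarrow> X"
  proof (rule lim)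
    show "(G has_vector_derivative X) (at 0 within {0..})"
      unfolding G_def by (rule exp_scaleR_has_vector_derivative_0)
  qed (simp add: G_def)
  obtain b where b: "norm (of_nat n *\<^sub>R (F (1 / of_nat n) - 1)) \<le> b" for n
    using convergent_imp_Bseq[OF convergentI[OF limF]] unfolding Bseq_def by blast
  obtain c where c: "norm (of_nat n *\<^sub>R (G (1 / of_nat n) - 1)) \<le> c" for n
    using convergent_imp_Bseq[OF convergentI[OF limG]] unfolding Bseq_def by blast
  define m where "m = max b c"
  have m0: "0 \<le> m" using b[of 0] by (auto simp: m_def)
  have bound: "norm Y \<le> exp (m / of_nat n)"
    if "n > 0" "norm (of_nat n *\<^sub>R (Y - 1)) \<le> m" for n and Y :: 'a
  proof -
    have "norm Y \<le> norm (1::'a) + norm (Y - 1)"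
      using norm_triangle_ineq[of 1 "Y - 1"] by simp
    also have "of_nat n * norm (Y - 1) \<le> m"
      using that(2) by (simp only: norm_scaleR abs_of_nat)
    then have "norm (1::'a) + norm (Y - 1) \<le> 1 + m / of_nat n"
      using that(1) by (simp add: pos_le_divide_eq mult.commute)
    also have "\<dots> \<le> exp (m / of_nat n)" by (rule exp_ge_add_one_self)
    finally show ?thesis .
  qed
  have diff: "norm (F (1 / of_nat n) ^ n - G (1 / of_nat n) ^ n)
      \<le> exp m * norm (of_nat n *\<^sub>R (F (1 / of_nat n) - 1) - of_nat n *\<^sub>R (G (1 / of_nat n) - 1))"
    if "n > 0" for n
  proof -
    have "norm (F (1 / of_nat n) ^ n - G (1 / of_nat n) ^ n)
        \<le> of_nat n * exp (m / of_nat n) ^ n * norm (F (1 / of_nat n) - G (1 / of_nat n))"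
      using that b[of n] c[of n] m0 by (intro norm_power_diff_le bound) (auto simp: m_def)
    also have "exp (m / of_nat n) ^ n = exp m"
      using that exp_of_nat_mult[of n "m / of_nat n"] by simp
    also have "of_nat n * exp m * norm (F (1 / of_nat n) - G (1 / of_nat n))
        = exp m * norm (of_nat n *\<^sub>R (F (1 / of_nat n) - G (1 / of_nat n)))"
      by simp
    finally show ?thesis by (simp add: algebra_simps)
  qed
  have "(\<lambda>n. exp m * norm (of_nat n *\<^sub>R (F (1 / of_nat n) - 1)
      - of_nat n *\<^sub>R (G (1 / of_nat n) - 1))) \<longlonglongrightarrow> exp m * norm (X - X)"
    by (intro tendsto_intros limF limG)
  then have "(\<lambda>n. exp m * norm (of_nat n *\<^sub>R (F (1 / of_nat n) - 1)
      - of_nat n *\<^sub>R (G (1 / of_nat n) - 1))) \<longlonglongrightarrow> 0"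
    by simp
  then have "(\<lambda>n. F (1 / of_nat n) ^ n - G (1 / of_nat n) ^ n) \<longlonglongrightarrow> 0"
    by (rule Lim_null_comparison[rotated])
       (rule eventually_sequentiallyI[of 1], rule diff, simp)
  moreover have "\<forall>\<^sub>F n in sequentially.
      F (1 / of_nat n) ^ n - G (1 / of_nat n) ^ n = F (1 / of_nat n) ^ n - exp X"
    by (rule eventually_sequentiallyI[of 1])
       (simp add: G_def flip: exp_of_nat_scaleR)
  ultimately have "(\<lambda>n. F (1 / of_nat n) ^ n - exp X) \<longlonglongrightarrow> 0"
    by (rule Lim_transform_eventually)
  then show ?thesis by (simp add: LIM_zero_iff)
qed

text \<open>The Euler products (1 + X/n)^n satisfy this Lipschitz bound uniformly in n, and
  \<open>chernoff\<close> carries it to the limit.\<close>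

lemma norm_exp_diff_le:
  fixes X Y :: "'a::{real_normed_algebra_1,banach}"
  assumes X: "norm X \<le> m" and Y: "norm Y \<le> m"
  shows "norm (exp X - exp Y) \<le> exp m * norm (X - Y)"
proof -
  have m0: "0 \<le> m" using X norm_ge_zero order_trans by blast
  define F where "F Z h = 1 + h *\<^sub>R Z" for Z :: 'a and h :: real
  have lim: "(\<lambda>n. F Z (1 / of_nat n) ^ n) \<longlonglongrightarrow> exp Z" for Z
  proof (rule chernoff)
    show "(F Z has_vector_derivative Z) (at 0 within {0..})"
      unfolding F_def by (auto intro!: derivative_eq_intros)
  qed (simp add: F_def)
  have bound: "norm (F Z (1 / of_nat n)) \<le> 1 + m / of_nat n" if "norm Z \<le> m" for Z n
    unfolding F_def
    by (rule order_trans[OF norm_triangle_ineq]) (use that in \<open>simp add: divide_right_mono\<close>)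
  have le: "norm (F X (1 / of_nat n) ^ n - F Y (1 / of_nat n) ^ n) \<le> exp m * norm (X - Y)"
    if "n > 0" for n
  proof -
    have "norm (F X (1 / of_nat n) ^ n - F Y (1 / of_nat n) ^ n)
        \<le> of_nat n * (1 + m / of_nat n) ^ n * norm (F X (1 / of_nat n) - F Y (1 / of_nat n))"
      using m0 by (intro norm_power_diff_le bound X Y) simp_all
    also have "F X (1 / of_nat n) - F Y (1 / of_nat n) = (1 / of_nat n) *\<^sub>R (X - Y)"
      by (simp add: F_def algebra_simps)
    also have "of_nat n * (1 + m / of_nat n) ^ n * norm ((1 / of_nat n) *\<^sub>R (X - Y))
        = (1 + m / of_nat n) ^ n * norm (X - Y)"
      using that by simp
    also have "(1 + m / of_nat n) ^ n \<le> exp m"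
      using that m0 by (intro exp_ge_one_plus_x_over_n_power_n) auto
    finally show ?thesis by (simp add: mult_right_mono)
  qed
  have "(\<lambda>n. norm (F X (1 / of_nat n) ^ n - F Y (1 / of_nat n) ^ n))
      \<longlonglongrightarrow> norm (exp X - exp Y)"
    by (intro tendsto_intros lim)
  then show ?thesis
    by (rule LIMSEQ_le_const2) (rule exI[of _ 1], use le in force)
qed

lemma tendsto_exp_banach:
  fixes f :: "'b \<Rightarrow> 'a::{real_normed_algebra_1,banach}"
  assumes f: "(f \<longlongrightarrow> X) F"
  shows "((\<lambda>x. exp (f x)) \<longlongrightarrow> exp X) F"
proof -
  have "\<forall>\<^sub>F x in F. dist (f x) X < 1" using f by (rule tendstoD) simp
  then have le: "\<forall>\<^sub>F x in F. norm (exp (f x) - exp X) \<le> exp (norm X + 1) * norm (f x - X)"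
  proof (rule eventually_mono)
    fix x assume "dist (f x) X < 1"
    then have "norm (f x) \<le> norm X + 1"
      using norm_triangle_sub[of "f x" X] by (simp add: dist_norm)
    then show "norm (exp (f x) - exp X) \<le> exp (norm X + 1) * norm (f x - X)"
      by (rule norm_exp_diff_le) simp
  qed
  have "((\<lambda>x. exp (norm X + 1) * norm (f x - X)) \<longlongrightarrow> exp (norm X + 1) * norm (X - X)) F"
    by (intro tendsto_intros f)
  then have "((\<lambda>x. exp (f x) - exp X) \<longlongrightarrow> 0) F"
    by (intro Lim_null_comparison[OF le]) simp
  then show ?thesis by (simp add: LIM_zero_iff)
qed

lemma continuous_on_exp_banach:
  fixes f :: "'b::topological_space \<Rightarrow> 'a::{real_normed_algebra_1,banach}"
  shows "continuous_on A f \<Longrightarrow> continuous_on A (\<lambda>x. exp (f x))"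
  unfolding continuous_on_def by (auto intro: tendsto_exp_banach)

lemma exp_conjugate:
  fixes X a b :: "'a::{real_normed_algebra_1,banach}"
  assumes "a * b = 1" "b * a = 1"
  shows "exp (a * X * b) = a * exp X * b"
proof -
  have power: "(a * X * b) ^ n = a * X ^ n * b" for n
  proof (induction n)
    case (Suc n)
    have "(a * X * b) ^ Suc n = a * X * (b * a) * X ^ n * b"
      using Suc by (simp add: mult.assoc)
    then show ?case using assms by (simp add: mult.assoc)
  qed (simp add: assms)
  have bl: "bounded_linear (\<lambda>Y. a * Y * b)"
    by (intro bounded_linear_mult_const bounded_linear_const_mult bounded_linear_ident)
  show ?thesis
    unfolding exp_def
    by (subst bounded_linear.suminf[OF bl summable_exp_generic])
       (simp add: power)
qed

text \<open>Powers of \<open>exp (t *\<^sub>R X)\<close> return arbitrarily close to \<open>1\<close>, so inverses are limits of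
  positive powers.\<close>

lemma exp_mem_of_bounded_orbit:
  fixes X :: "'a::{real_normed_algebra_1,banach,heine_borel}"
  assumes closed: "closed S"
    and S: "\<And>t. 0 \<le> t \<Longrightarrow> exp (t *\<^sub>R X) \<in> S"
    and b: "\<And>t. norm (exp (t *\<^sub>R X)) \<le> b"
  shows "exp (t *\<^sub>R X) \<in> S"
proof (cases "0 \<le> t")
  case True
  then show ?thesis by (rule S)
next
  case False
  define s where "s = - t"
  have s: "s > 0" using False by (simp add: s_def)
  have b0: "0 \<le> b" using b[of 0] by simp
  define g where "g k = exp ((of_nat k * s) *\<^sub>R X)" for k
  have "bounded (range g)"
    using b by (auto simp: g_def bounded_iff)
  then obtain l r where r: "strict_mono r" and l: "(g \<circ> r) \<longlonglongrightarrow> l"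
    using bounded_imp_convergent_subsequence by blast
  have "exp ((- s) *\<^sub>R X) \<in> closure S"
    unfolding closure_approachable
  proof (intro allI impI)
    fix e :: real assume "e > 0"
    \<comment> \<open>Dividing by \<open>b * b + 1\<close> leaves room for the factor
      \<open>b\<close> picked up below, since b < b * b + 1 for every real b.\<close>
    then have "e / (b * b + 1) > 0" by (simp add: add_nonneg_pos)
    then obtain M where M: "\<And>m n. M \<le> m \<Longrightarrow> M \<le> n \<Longrightarrow> dist ((g \<circ> r) m) ((g \<circ> r) n) < e / (b * b + 1)"
      using LIMSEQ_imp_Cauchy[OF l] unfolding Cauchy_def by meson
    define i j where "i = r M" and "j = r (Suc M)"
    have ij: "i < j" unfolding i_def j_def using r by (simp add: strict_mono_Suc_iff)
    have d: "norm (g j - g i) < e / (b * b + 1)"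
      using M[of "Suc M" M] by (simp add: i_def j_def dist_norm)
    \<comment> \<open>\<open>g i\<close> and \<open>g j\<close> are close, so exp ((j - i) s X) is
      close to 1; one step of length \<open>s\<close> less is still a nonnegative time, and its
      exponential is close to exp (- s X).\<close>
    define u where "u = (of_nat j - of_nat i - 1) * s"
    have "0 \<le> u" using ij s by (simp add: u_def)
    have "exp (u *\<^sub>R X) - exp ((- s) *\<^sub>R X) = (g j - g i) * exp ((- (of_nat i * s) - s) *\<^sub>R X)"
      unfolding g_def left_diff_distrib exp_scaleR_add[symmetric]
      by (simp add: u_def algebra_simps)
    then have "norm (exp (u *\<^sub>R X) - exp ((- s) *\<^sub>R X)) \<le> norm (g j - g i) * b"
      using b by (auto intro!: order_trans[OF norm_mult_ineq] mult_left_mono)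
    also have "\<dots> \<le> e / (b * b + 1) * b" using d b0 by (intro mult_right_mono) auto
    also have "\<dots> < e"
    proof -
      have "b < b * b + 1"
        using zero_le_square[of "b - 1 / 2"] by (simp add: algebra_simps)
      moreover have "b * b + 1 > 0" by (simp add: add_nonneg_pos)
      ultimately show ?thesis using \<open>e > 0\<close> by (simp add: divide_less_eq)
    qed
    finally show "\<exists>y\<in>S. dist y (exp ((- s) *\<^sub>R X)) < e"
      using S[OF \<open>0 \<le> u\<close>] by (auto simp: dist_norm)
  qed
  then show ?thesis using closed by (simp add: s_def)
qed

section \<open>The Lie algebra of one-parameter groups in a closed monoid\<close>

locale closed_submonoid =
  fixes S :: "'a::{real_normed_algebra_1,banach} set"
  assumes closed: "closed S"
    and one_mem: "1 \<in> S"
    and mult_mem: "a \<in> S \<Longrightarrow> b \<in> S \<Longrightarrow> a * b \<in> S"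
begin

text \<open>Requiring all real t puts inverses into \<open>S\<close>, which conjugation needs; a
  semigroup that lies in \<open>S\<close> for nonnegative times only does not qualify.\<close>

definition generators :: "'a set" where
  "generators = {X. \<forall>t. exp (t *\<^sub>R X) \<in> S}"

lemma generatorsD: "X \<in> generators \<Longrightarrow> exp (t *\<^sub>R X) \<in> S"
  by (simp add: generators_def)

lemma power_mem: "a \<in> S \<Longrightarrow> a ^ n \<in> S"
  by (induction n) (auto intro: one_mem mult_mem)

lemma generators_scaleR: "X \<in> generators \<Longrightarrow> c *\<^sub>R X \<in> generators"
  by (auto simp: generators_def)

text \<open>The Trotter product formula, as the instance of \<open>chernoff\<close> for the curve
  exp (h t X) exp (h t Y).\<close>

lemma generators_add:
  assumes "X \<in> generators" "Y \<in> generators"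
  shows "X + Y \<in> generators"
proof -
  have "exp (t *\<^sub>R (X + Y)) \<in> S" for t
  proof -
    define F where "F h = exp (h *\<^sub>R (t *\<^sub>R X)) * exp (h *\<^sub>R (t *\<^sub>R Y))" for h
    have "(F has_vector_derivative exp (0 *\<^sub>R (t *\<^sub>R X)) * (t *\<^sub>R Y) + t *\<^sub>R X * exp (0 *\<^sub>R (t *\<^sub>R Y)))
        (at 0 within {0..})"
      unfolding F_def
      by (intro has_vector_derivative_mult exp_scaleR_has_vector_derivative_0)
    then have "(F has_vector_derivative t *\<^sub>R (X + Y)) (at 0 within {0..})"
      by (simp add: algebra_simps)
    then have lim: "(\<lambda>n. F (1 / of_nat n) ^ n) \<longlonglongrightarrow> exp (t *\<^sub>R (X + Y))"
      by (intro chernoff) (simp_all add: F_def[of 0])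
    have "F (1 / of_nat n) ^ n \<in> S" for n
      unfolding F_def using assms
      by (intro power_mem mult_mem) (simp_all add: generatorsD)
    then show ?thesis
      by (rule closed_sequentially[OF closed _ lim])
  qed
  then show ?thesis by (simp add: generators_def)
qed

lemma subspace_generators: "subspace generators"
  by (auto simp: subspace_def generators_add generators_scaleR)
     (simp add: generators_def one_mem)

lemma closed_generators: "closed generators"
proof -
  have "generators = (\<Inter>t. (\<lambda>X. exp (t *\<^sub>R X)) -` S)"
    by (auto simp: generators_def)
  moreover have "closed ((\<lambda>X. exp (t *\<^sub>R X)) -` S)" for t
    using closed by (intro closed_vimage continuous_on_exp_banach continuous_intros)
  ultimately show ?thesis by auto
qed

lemma generators_conjugate:
  assumes "a \<in> S" "b \<in> S" "a * b = 1" "b * a = 1" "X \<in> generators"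
  shows "a * X * b \<in> generators"
proof -
  have "exp (t *\<^sub>R (a * X * b)) = a * exp (t *\<^sub>R X) * b" for t
    using exp_conjugate[OF assms(3,4), of "t *\<^sub>R X"] by simp
  then show ?thesis
    using assms by (auto simp: generators_def intro!: mult_mem)
qed

text \<open>The conjugates of Y by exp (s X) stay in the set, and the bracket is their derivative at
  s = 0, a limit of difference quotients in a closed subspace.\<close>

lemma generators_bracket:
  assumes X: "X \<in> generators" and Y: "Y \<in> generators"
  shows "X * Y - Y * X \<in> generators"
proof -
  define f where "f s = exp (s *\<^sub>R X) * Y * exp (s *\<^sub>R (- X))" for s
  have f: "f s \<in> generators" for s
    unfolding f_def using exp_scaleR_minus_inverse[of s X] X
    by (intro generators_conjugate Y) (use generatorsD[OF X, of s] generatorsD[OF X, of "- s"] in auto)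
  have "(f has_vector_derivative
      (exp (0 *\<^sub>R X) * Y) * (- X) + (exp (0 *\<^sub>R X) * 0 + X * Y) * exp (0 *\<^sub>R (- X))) (at 0)"
    unfolding f_def
    by (intro has_vector_derivative_mult exp_scaleR_has_vector_derivative_0 has_vector_derivative_const)
  then have "(f has_vector_derivative (X * Y - Y * X)) (at 0)"
    by simp
  then have lim: "((\<lambda>h. (f h - f 0) /\<^sub>R h) \<longlongrightarrow> X * Y - Y * X) (at 0)"
    by (auto dest: has_vector_derivative_imp_quotient_tendsto)
  have "(f h - f 0) /\<^sub>R h \<in> generators" for h
    using f subspace_generators by (intro subspace_scale subspace_diff) auto
  then show ?thesis
    by (intro Lim_in_closed_set[OF closed_generators _ _ lim]) simp_all
qed

end

section \<open>Linear flows\<close>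

definition flow :: "'a endo \<Rightarrow> real \<Rightarrow> 'a::euclidean_space \<Rightarrow> 'a" where
  "flow L t x = endo_apply (exp (t *\<^sub>R L)) x"

lemma flow_0 [simp]: "flow L 0 x = x"
  by (simp add: flow_def)

lemma flow_add: "flow L (s + t) x = flow L s (flow L t x)"
  by (simp add: flow_def exp_scaleR_add)

lemma flow_minus [simp]: "flow L (- t) (flow L t x) = x" "flow L t (flow L (- t) x) = x"
  by (simp_all flip: flow_add)

lemma flow_has_vector_derivative:
  "((\<lambda>t. flow L t x) has_vector_derivative endo_apply L (flow L t x)) (at t within S)"
proof -
  have "((\<lambda>t. endo_apply (exp (t *\<^sub>R L)) x) has_vector_derivative
      endo_apply (exp (t *\<^sub>R L)) 0 + endo_apply (L * exp (t *\<^sub>R L)) x) (at t within S)"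
    by (intro endo.has_vector_derivative has_vector_derivative_const
        has_vector_derivative_at_within[OF exp_scaleR_has_vector_derivative_left])
  then show ?thesis by (simp add: flow_def endo.zero_right)
qed

lemma linear_flow: "linear (flow L t)"
  by (rule linearI) (simp_all add: flow_def endo.add_right endo.scaleR_right)

lemma continuous_on_flow: "continuous_on S (\<lambda>t. flow L t x)"
  by (rule continuous_on_vector_derivative) (rule flow_has_vector_derivative)

text \<open>Transporting y(t) to the final time by exp ((b - t) L) gives a curve with zero
  derivative off \<open>K\<close>; continuity bridges the exceptional points.\<close>

lemma flow_unique:
  assumes ab: "a \<le> b" and K: "finite K" and cont: "continuous_on {a..b} y"
    and y: "\<And>t. t \<in> {a<..<b} - K \<Longrightarrow> (y has_vector_derivative endo_apply L (y t)) (at t)"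
  shows "y b = flow L (b - a) (y a)"
proof -
  define g where "g t = endo_apply (exp ((b - t) *\<^sub>R L)) (y t)" for t
  have E: "((\<lambda>t. exp ((b - t) *\<^sub>R L)) has_vector_derivative - (exp ((b - t) *\<^sub>R L) * L)) (at t within S)"
    for t S
  proof -
    have "((\<lambda>s. b - s) has_vector_derivative - 1) (at t within S)"
      by (auto intro!: derivative_eq_intros)
    then have "(((\<lambda>s. exp (s *\<^sub>R L)) \<circ> (\<lambda>s. b - s)) has_vector_derivative
        (- 1) *\<^sub>R (exp ((b - t) *\<^sub>R L) * L)) (at t within S)"
      by (rule vector_diff_chain_within) (rule exp_scaleR_has_vector_derivative_right)
    then show ?thesis by (simp add: o_def)
  qed
  have g: "(g has_vector_derivative 0) (at t)" if "t \<in> {a<..<b} - K" for t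
  proof -
    have "(g has_vector_derivative endo_apply (exp ((b - t) *\<^sub>R L)) (endo_apply L (y t))
        + endo_apply (- (exp ((b - t) *\<^sub>R L) * L)) (y t)) (at t)"
      unfolding g_def by (intro endo.has_vector_derivative E y that)
    then show ?thesis by (simp add: endo.minus_left)
  qed
  have "continuous_on {a..b} g"
    unfolding g_def
    by (intro endo.continuous_on cont continuous_on_vector_derivative[OF E])
  then have "g b = g a"
  proof (rule has_derivative_zero_unique_strong_interval[where k = "insert a (insert b K)", rotated])
    fix t assume "t \<in> {a..b} - insert a (insert b K)"
    then show "(g has_derivative (\<lambda>h. 0)) (at t within {a..b})"
      using g[of t] by (auto simp: has_vector_derivative_def intro: has_derivative_at_withinI)
  qed (use ab K in auto)
  then show ?thesis by (simp add: g_def flow_def)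
qed

lemma flow_unique':
  assumes "\<And>t. (y has_vector_derivative endo_apply L (y t)) (at t)" "0 \<le> t"
  shows "y t = flow L t (y 0)"
proof -
  have "continuous_on {0..t} y"
    by (rule continuous_on_vector_derivative) (rule has_vector_derivative_at_within[OF assms(1)])
  then show ?thesis using flow_unique[of 0 t "{}" y L] assms by simp
qed

lemma norm_flow:
  assumes skew: "\<And>x. inner x (endo_apply L x) = 0"
  shows "norm (flow L t x) = norm x"
proof -
  have "((\<lambda>t. flow L t x \<bullet> flow L t x) has_vector_derivative
      flow L t x \<bullet> endo_apply L (flow L t x) + endo_apply L (flow L t x) \<bullet> flow L t x) (at t within UNIV)"
    for t
    by (intro bounded_bilinear.has_vector_derivative[OF bounded_bilinear_inner] flow_has_vector_derivative)
  then have "((\<lambda>t. flow L t x \<bullet> flow L t x) has_vector_derivative 0) (at t within UNIV)" for t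
    by (simp add: skew inner_commute[of "endo_apply L _"])
  then obtain c where "\<And>t. flow L t x \<bullet> flow L t x = c"
    using has_vector_derivative_zero_constant[of UNIV "\<lambda>t. flow L t x \<bullet> flow L t x"]
    by auto
  then have "flow L t x \<bullet> flow L t x = flow L 0 x \<bullet> flow L 0 x" by metis
  then show ?thesis by (simp add: norm_eq_sqrt_inner)
qed

lemma norm_endo_le:
  assumes "0 \<le> b" "\<And>x. norm (endo_apply T x) \<le> b * norm x"
  shows "norm T \<le> b"
  using assms by transfer (rule norm_blinfun_bound)

text \<open>Chernoff's formula with the approximants \<open>1 + h L + h\<^sup>2 R\<close>: invariance of a closed set
  only has to be checked to first order, up to a convenient second order term.\<close>

lemma flow_mem_closed:
  assumes D: "closed D" and x: "x \<in> D" and t: "0 \<le> t"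
    and step: "\<And>h x. 0 \<le> h \<Longrightarrow> x \<in> D \<Longrightarrow>
      x + h *\<^sub>R endo_apply L x + (h * h) *\<^sub>R endo_apply R x \<in> D"
  shows "flow L t x \<in> D"
proof -
  define F where "F h = 1 + (t * h) *\<^sub>R L + (t * h * (t * h)) *\<^sub>R R" for h
  have "(F has_vector_derivative t *\<^sub>R L) (at 0 within {0..})"
    unfolding F_def by (auto intro!: derivative_eq_intros)
  then have "(\<lambda>n. F (1 / of_nat n) ^ n) \<longlonglongrightarrow> exp (t *\<^sub>R L)"
    by (rule chernoff[rotated]) (simp add: F_def)
  then have lim: "(\<lambda>n. endo_apply (F (1 / of_nat n) ^ n) x) \<longlonglongrightarrow> flow L t x"
    unfolding flow_def by (intro endo.tendsto tendsto_const)
  have F: "endo_apply (F h) x \<in> D" if "0 \<le> h" "x \<in> D" for h x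
    using step[of "t * h" x] t that by (simp add: F_def endo.add_left endo.scaleR_left)
  have "endo_apply (F h ^ n) x \<in> D" if "0 \<le> h" for h n
    using that by (induction n) (simp_all add: x F)
  then show ?thesis
    by (intro closed_sequentially[OF D _ lim]) simp
qed

text \<open>Any point of \<open>D\<close> strictly inside splits the interval into two with fewer
  such points, so switching times never have to be sorted.\<close>

lemma finite_partition_induct:
  fixes P :: "real \<Rightarrow> bool"
  assumes "finite D" "s \<le> t" "P s"
    and step: "\<And>a b. s \<le> a \<Longrightarrow> a < b \<Longrightarrow> b \<le> t \<Longrightarrow> {a<..<b} \<inter> D = {} \<Longrightarrow> P a \<Longrightarrow> P b"
  shows "P t"
proof -
  have "finite (D \<inter> {s<..<t})" using assms by simp
  then show ?thesis using assms(2-)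
  proof (induction "card (D \<inter> {s<..<t})" arbitrary: s t rule: less_induct)
    case less
    show ?case
    proof (cases "s = t \<or> {s<..<t} \<inter> D = {}")
      case True
      then show ?thesis using less.prems by (metis order.order_iff_strict order_refl)
    next
      case False
      then obtain d where d: "d \<in> D" "s < d" "d < t" by auto
      have "D \<inter> {s<..<d} \<subset> D \<inter> {s<..<t}" "D \<inter> {d<..<t} \<subset> D \<inter> {s<..<t}" using d by auto
      then have c: "card (D \<inter> {s<..<d}) < card (D \<inter> {s<..<t})" "card (D \<inter> {d<..<t}) < card (D \<inter> {s<..<t})"
        using less.prems(1) by (auto intro: psubset_card_mono)
      have fin: "finite (D \<inter> {s<..<d})" "finite (D \<inter> {d<..<t})"
        using less.prems(1) d by (auto elim!: finite_subset[rotated])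
      have "P d"
        using d less.prems by (intro less.hyps[OF c(1) fin(1)]) auto
      then show ?thesis
      proof (intro less.hyps[OF c(2) fin(2)])
        fix a b assume "d \<le> a" "a < b" "b \<le> t" "{a<..<b} \<inter> D = {}" "P a"
        then show "P b" using less.prems(4)[of a b] d by simp
      qed (use \<open>P d\<close> d in auto)
    qed
  qed
qed

section \<open>Complex matrices\<close>

lemma matrix_mult_nth: "(A ** B) $ i $ j = (\<Sum>k\<in>UNIV. A $ i $ k * B $ k $ j)"
  by (simp add: matrix_matrix_mult_def)

lemma matrix_mult_scaleR_left: "(c *\<^sub>R A) ** B = c *\<^sub>R (A ** (B :: 'd::finite cmatrix))"
  by (simp add: vec_eq_iff matrix_mult_nth scaleR_sum_right)

lemma matrix_mult_scaleR_right: "A ** (c *\<^sub>R B) = c *\<^sub>R (A ** (B :: 'd::finite cmatrix))"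
  by (simp add: vec_eq_iff matrix_mult_nth scaleR_sum_right)

lemma matrix_mult_minus_left: "(- A) ** B = - (A ** (B :: 'd::finite cmatrix))"
  by (simp add: vec_eq_iff matrix_mult_nth sum_negf)

lemma matrix_mult_minus_right: "A ** (- B) = - (A ** (B :: 'd::finite cmatrix))"
  by (simp add: vec_eq_iff matrix_mult_nth sum_negf)

lemma matrix_mult_zero [simp]: "0 ** A = (0 :: 'd::finite cmatrix)" "A ** 0 = (0 :: 'd::finite cmatrix)"
  by (simp_all add: vec_eq_iff matrix_mult_nth)

lemma matrix_mult_add_left: "(A + B) ** C = A ** C + B ** (C :: 'd::finite cmatrix)"
  by (simp add: vec_eq_iff matrix_mult_nth distrib_right sum.distrib)

lemma matrix_mult_diff_left: "(A - B) ** C = A ** C - B ** (C :: 'd::finite cmatrix)"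
  by (simp add: vec_eq_iff matrix_mult_nth left_diff_distrib sum_subtractf)

lemma matrix_mult_diff_right: "A ** (B - C) = A ** B - A ** (C :: 'd::finite cmatrix)"
  by (simp add: vec_eq_iff matrix_mult_nth right_diff_distrib sum_subtractf)

lemmas cmatrix_algebra =
  matrix_add_ldistrib matrix_mult_add_left matrix_mult_scaleR_left matrix_mult_scaleR_right
  matrix_mult_minus_left matrix_mult_minus_right matrix_mult_diff_left matrix_mult_diff_right
  matrix_mul_assoc

lemma dagger_nth [simp]: "dagger A $ i $ j = cnj (A $ j $ i)"
  by (simp add: dagger_def)

lemma cscale_nth [simp]: "cscale c A $ i $ j = c * A $ i $ j"
  by (simp add: cscale_def)

lemma dagger_dagger [simp]: "dagger (dagger A) = A"
  by (simp add: vec_eq_iff)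

lemma dagger_mult: "dagger (A ** B) = dagger B ** dagger A"
  by (simp add: vec_eq_iff matrix_mult_nth mult.commute)

lemma dagger_add: "dagger (A + B) = dagger A + dagger B"
  by (simp add: vec_eq_iff)

lemma dagger_scaleR: "dagger (c *\<^sub>R A) = c *\<^sub>R dagger A"
  by (simp add: vec_eq_iff)

lemma dagger_cscale: "dagger (cscale c A) = cscale (cnj c) (dagger A)"
  by (simp add: vec_eq_iff)

lemma dagger_minus: "dagger (- A) = - dagger A"
  by (simp add: vec_eq_iff)

lemma dagger_zero [simp]: "dagger 0 = 0"
  by (simp add: vec_eq_iff)

lemma dagger_mat_1 [simp]: "dagger (mat 1) = mat 1"
  by (simp add: vec_eq_iff mat_def)

lemma trace_dagger: "trace (dagger A) = cnj (trace A)"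
  by (simp add: trace_def)

lemma trace_scaleR: "trace (c *\<^sub>R A) = c *\<^sub>R trace (A :: 'd::finite cmatrix)"
  by (simp add: trace_def scaleR_sum_right)

lemma trace_minus: "trace (- A) = - trace (A :: 'd::finite cmatrix)"
  by (simp add: trace_def sum_negf)

lemma linear_trace: "linear (trace :: 'd::finite cmatrix \<Rightarrow> complex)"
  by (rule linearI) (simp_all add: trace_add trace_scaleR)

text \<open>Identifies the Euclidean structure of the matrix type with the Hilbert-Schmidt one, so
  that trace identities control norms.\<close>

lemma inner_cmatrix: "inner X Y = Re (trace (dagger X ** (Y :: 'd::finite cmatrix)))"
proof -
  have "inner X Y = (\<Sum>i\<in>UNIV. \<Sum>j\<in>UNIV. Re (cnj (X $ i $ j) * Y $ i $ j))"
    by (simp add: inner_vec_def inner_complex_def)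
  also have "\<dots> = (\<Sum>j\<in>UNIV. \<Sum>i\<in>UNIV. Re (cnj (X $ i $ j) * Y $ i $ j))"
    by (rule sum.swap)
  finally show ?thesis by (simp add: trace_def matrix_mult_nth)
qed

section \<open>Commutators as endomorphisms\<close>

definition ad :: "'d cmatrix \<Rightarrow> 'd::finite cmatrix endo" where
  "ad A = endo_of (commutator A)"

lemma ad_apply: "endo_apply (ad A) X = A ** X - X ** A"
proof -
  have "linear (commutator A)"
    by (rule linearI) (simp_all add: commutator_def cmatrix_algebra algebra_simps)
  then show ?thesis by (simp add: ad_def endo_apply_endo_of commutator_def)
qed

lemma linear_ad: "linear ad"
  by (rule linearI; rule endo_eqI)
     (simp_all add: ad_apply endo.add_left endo.scaleR_left cmatrix_algebra algebra_simps)

lemma ad_commutator: "ad (commutator A B) = ad A * ad B - ad B * ad A"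
  by (rule endo_eqI) (simp add: ad_apply commutator_def endo.diff_left cmatrix_algebra algebra_simps)

text \<open>The traces of \<open>dagger X ** A ** X\<close> and \<open>dagger X ** X ** A\<close>
  are purely imaginary: the first matrix is skew-hermitian, the second is so up to a cyclic
  permutation under the trace. Hence these commutator flows are isometries.\<close>

lemma inner_ad_skew:
  assumes "dagger A = - A"
  shows "inner X (endo_apply (ad A) X) = 0"
proof -
  have Re0: "Re (trace M) = 0" if "trace (dagger M) = - trace M" for M :: "'a cmatrix"
    using arg_cong[OF that, of Re] by (simp add: trace_dagger)
  have "Re (trace (dagger X ** A ** X)) = 0"
    by (rule Re0) (simp add: dagger_mult assms cmatrix_algebra trace_minus)
  moreover have "Re (trace (dagger X ** X ** A)) = 0"
    using trace_mul_sym[of A "dagger X ** X"]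
    by (intro Re0) (simp add: dagger_mult assms cmatrix_algebra trace_minus)
  ultimately show ?thesis
    by (simp add: ad_apply inner_cmatrix cmatrix_algebra trace_sub)
qed

lemma norm_flow_ad: "dagger A = - A \<Longrightarrow> norm (flow (ad A) t X) = norm X"
  by (intro norm_flow inner_ad_skew)

lemma norm_exp_ad_le: "dagger A = - A \<Longrightarrow> norm (exp (t *\<^sub>R ad A)) \<le> 1"
  by (intro norm_endo_le) (simp_all add: norm_flow_ad flip: flow_def)

section \<open>Lindblad generators preserve density matrices\<close>

text \<open>\<open>K\<close> plays the role of -i H minus half of \<open>dagger V ** V\<close>. In
  this form positivity of the flow holds for all \<open>K\<close> and \<open>V\<close>, and trace
  preservation is the single identity \<open>K + dagger K + dagger V ** V = 0\<close>.\<close>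

definition lindblad :: "'d cmatrix \<Rightarrow> 'd cmatrix \<Rightarrow> 'd::finite cmatrix endo" where
  "lindblad K V = endo_of (\<lambda>X. K ** X + X ** dagger K + V ** X ** dagger V)"

lemma lindblad_apply:
  "endo_apply (lindblad K V) X = K ** X + X ** dagger K + V ** X ** dagger V"
proof -
  have "linear (\<lambda>X. K ** X + X ** dagger K + V ** X ** dagger V)"
    by (rule linearI) (simp_all add: cmatrix_algebra algebra_simps)
  then show ?thesis by (simp add: lindblad_def endo_apply_endo_of)
qed

lemma ad_eq_lindblad: "dagger A = - A \<Longrightarrow> ad A = lindblad A 0"
  by (rule endo_eqI) (simp add: ad_apply lindblad_apply cmatrix_algebra)

definition cdot :: "complex^'d \<Rightarrow> complex^'d::finite \<Rightarrow> complex" where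
  "cdot u v = (\<Sum>i\<in>UNIV. cnj (u $ i) * v $ i)"

lemma cdot_dagger: "cdot u (A *v w) = cdot (dagger A *v u) w"
proof -
  have "cdot u (A *v w) = (\<Sum>i\<in>UNIV. \<Sum>j\<in>UNIV. cnj (u $ i) * (A $ i $ j * w $ j))"
    by (simp add: cdot_def matrix_vector_mult_def sum_distrib_left)
  also have "\<dots> = (\<Sum>j\<in>UNIV. \<Sum>i\<in>UNIV. cnj (u $ i) * (A $ i $ j * w $ j))"
    by (rule sum.swap)
  also have "\<dots> = cdot (dagger A *v u) w"
    by (simp add: cdot_def matrix_vector_mult_def sum_distrib_left sum_distrib_right mult_ac)
  finally show ?thesis .
qed

lemma pos_semidefinite_iff:
  "pos_semidefinite A \<longleftrightarrow> dagger A = A \<and> (\<forall>v. 0 \<le> Re (cdot v (A *v v)))"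
  by (simp add: pos_semidefinite_def hermitian_def cdot_def)

lemma pos_semidefinite_sandwich:
  assumes "pos_semidefinite A"
  shows "pos_semidefinite (M ** A ** dagger M)"
proof -
  have "cdot v ((M ** A ** dagger M) *v v) = cdot (dagger M *v v) (A *v (dagger M *v v))" for v
    by (simp add: cdot_dagger flip: matrix_vector_mul_assoc)
  then show ?thesis
    using assms by (simp add: pos_semidefinite_iff dagger_mult matrix_mul_assoc)
qed

lemma pos_semidefinite_add:
  "pos_semidefinite A \<Longrightarrow> pos_semidefinite B \<Longrightarrow> pos_semidefinite (A + B)"
  by (auto simp: pos_semidefinite_iff dagger_add cdot_def matrix_vector_mult_add_rdistrib
      distrib_left sum.distrib)

lemma pos_semidefinite_scaleR:
  assumes "pos_semidefinite A" "0 \<le> c"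
  shows "pos_semidefinite (c *\<^sub>R A)"
proof -
  have "cdot v ((c *\<^sub>R A) *v v) = c *\<^sub>R cdot v (A *v v)" for v
    by (simp add: cdot_def matrix_vector_mult_def scaleR_sum_right sum_distrib_left)
  then show ?thesis using assms by (simp add: pos_semidefinite_iff dagger_scaleR)
qed

lemma closed_pos_semidefinite: "closed {A :: 'd::finite cmatrix. pos_semidefinite A}"
proof -
  have "closed {A :: 'd cmatrix. \<forall>i j. cnj (A $ j $ i) = A $ i $ j}"
    by (intro closed_Collect_all closed_Collect_eq continuous_intros)
  moreover have "closed {A :: 'd cmatrix. \<forall>v. 0 \<le> Re (cdot v (A *v v))}"
    unfolding cdot_def matrix_vector_mult_def
    by (intro closed_Collect_all closed_Collect_le) (auto intro!: continuous_intros)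
  ultimately have "closed ({A :: 'd cmatrix. \<forall>i j. cnj (A $ j $ i) = A $ i $ j}
      \<inter> {A. \<forall>v. 0 \<le> Re (cdot v (A *v v))})"
    by (rule closed_Int)
  then show ?thesis
    by (simp add: pos_semidefinite_iff vec_eq_iff Collect_conj_eq)
qed

lemma closed_density_matrices: "closed (density_matrices :: 'd::finite cmatrix set)"
proof -
  have "closed {A :: 'd cmatrix. trace A = 1}"
    unfolding trace_def by (intro closed_Collect_eq continuous_intros)
  then show ?thesis
    unfolding density_matrices_def Collect_conj_eq
    by (intro closed_Int closed_pos_semidefinite)
qed

lemma density_diag_nonneg:
  assumes "pos_semidefinite A"
  shows "0 \<le> Re (A $ i $ i)" "Im (A $ i $ i) = 0"
proof -
  have "cdot (axis i 1) (A *v axis i 1) = A $ i $ i"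
    by (simp add: cdot_def matrix_vector_mult_def axis_def if_distrib[of cnj] if_distrib[of "\<lambda>x. _ * x"]
        if_distrib[of "\<lambda>x. x * _"] cong: if_cong)
  then show "0 \<le> Re (A $ i $ i)"
    using assms unfolding pos_semidefinite_iff by metis
  have "cnj (A $ i $ i) = A $ i $ i"
    using assms by (metis dagger_nth pos_semidefinite_iff)
  then show "Im (A $ i $ i) = 0" by (simp add: complex_eq_iff)
qed

lemma pos_semidefinite_entry_le:
  assumes A: "pos_semidefinite A"
  shows "2 * norm (A $ i $ j) \<le> Re (A $ i $ i) + Re (A $ j $ j)"
proof (cases "i = j")
  case True
  then show ?thesis using density_diag_nonneg[OF A, of i] by (simp add: cmod_eq_Re)
next
  case False
  \<comment> \<open>This phase turns the off-diagonal part of the quadratic form at e_i + z e_j into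
    -2 |A_ij|. If the entry vanishes, \<open>sgn\<close> gives z = 0, so only norm z at most 1 can
    be claimed.\<close>
  define z where "z = - cnj (sgn (A $ i $ j))"
  define v where "v = axis i 1 + axis j z"
  have ji: "A $ j $ i = cnj (A $ i $ j)"
    using A by (metis dagger_nth pos_semidefinite_iff)
  have Av: "(A *v v) $ k = A $ k $ i + A $ k $ j * z" for k
    by (simp add: v_def matrix_vector_mult_def axis_def distrib_left sum.distrib
        if_distrib[of "\<lambda>x. _ * x"] cong: if_cong)
  have "cdot v (A *v v) = (A $ i $ i + A $ i $ j * z) + cnj z * (A $ j $ i + A $ j $ j * z)"
    by (simp add: cdot_def Av) (simp add: v_def axis_def distrib_right sum.distrib
        if_distrib[of cnj] if_distrib[of "\<lambda>x. x * _"] cong: if_cong)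
  moreover have zA: "A $ i $ j * z = - norm (A $ i $ j)"
  proof -
    have "A $ i $ j * cnj (sgn (A $ i $ j)) = cnj (sgn (A $ i $ j)) * sgn (A $ i $ j) * norm (A $ i $ j)"
      by (cases "A $ i $ j = 0") (simp_all add: sgn_eq)
    also have "cnj (sgn (A $ i $ j)) * sgn (A $ i $ j) = of_real ((norm (sgn (A $ i $ j)))\<^sup>2)"
      by (simp add: complex_norm_square mult.commute del: of_real_power)
    finally show ?thesis
      by (cases "A $ i $ j = 0") (simp_all add: z_def norm_sgn)
  qed
  moreover have "cnj z * A $ j $ i = - norm (A $ i $ j)"
    using arg_cong[OF zA, of cnj] by (simp add: ji mult.commute)
  moreover have "Re (cnj z * (A $ j $ j * z)) \<le> Re (A $ j $ j)"
  proof -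
    have "Re (cnj z * (A $ j $ j * z)) = (norm z)\<^sup>2 * Re (A $ j $ j)"
      unfolding cmod_power2 by (simp add: power2_eq_square algebra_simps)
    moreover have "(norm z)\<^sup>2 \<le> 1"
      by (simp add: z_def norm_sgn)
    ultimately show ?thesis
      using density_diag_nonneg(1)[OF A, of j] by (simp add: mult_left_le_one_le)
  qed
  ultimately have "Re (cdot v (A *v v)) \<le> Re (A $ i $ i) - norm (A $ i $ j) - norm (A $ i $ j) + Re (A $ j $ j)"
    by (simp add: distrib_left)
  moreover have "0 \<le> Re (cdot v (A *v v))"
    using A by (simp add: pos_semidefinite_iff)
  ultimately show ?thesis by simp
qed

lemma density_diag_le_1:
  assumes "A \<in> density_matrices"
  shows "Re (A $ i $ i) \<le> 1"
proof -
  have "Re (A $ i $ i) \<le> (\<Sum>k\<in>UNIV. Re (A $ k $ k))"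
    using assms by (intro member_le_sum) (auto simp: density_matrices_def density_diag_nonneg)
  also have "\<dots> = Re (trace A)" by (simp add: trace_def)
  finally show ?thesis using assms by (simp add: density_matrices_def)
qed

lemma compact_density_matrices: "compact (density_matrices :: 'd::finite cmatrix set)"
proof -
  have "norm A \<le> real CARD('d) * real CARD('d)" if A: "A \<in> density_matrices" for A :: "'d cmatrix"
  proof -
    have entry: "norm (A $ i $ j) \<le> 1" for i j
      using pos_semidefinite_entry_le[of A i j] density_diag_le_1[OF A, of i] density_diag_le_1[OF A, of j] A
      by (simp add: density_matrices_def)
    have "norm A \<le> (\<Sum>i\<in>UNIV. norm (A $ i))"
      by (simp add: norm_vec_def L2_set_le_sum)
    also have "\<dots> \<le> (\<Sum>i\<in>UNIV. \<Sum>j\<in>UNIV. norm (A $ i $ j))"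
      by (intro sum_mono) (simp add: norm_vec_def L2_set_le_sum)
    also have "\<dots> \<le> (\<Sum>i\<in>(UNIV::'d set). \<Sum>j\<in>(UNIV::'d set). 1)"
      by (intro sum_mono entry)
    finally show ?thesis by simp
  qed
  then have "bounded (density_matrices :: 'd cmatrix set)" by (auto simp: bounded_iff)
  then show ?thesis using closed_density_matrices by (simp add: compact_eq_bounded_closed)
qed

text \<open>The second order term h^2 K X \<open>dagger K\<close> completes the Euler step to a
  sandwich of X by \<open>mat 1 + h *\<^sub>R K\<close> plus a nonnegative multiple of the sandwich
  by V, which is visibly positive.\<close>

lemma flow_lindblad_pos_semidefinite:
  fixes K V X :: "'d::finite cmatrix"
  assumes "pos_semidefinite X" "0 \<le> t"
  shows "pos_semidefinite (flow (lindblad K V) t X)"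
proof -
  define R where "R = endo_of (\<lambda>X. K ** X ** dagger K)"
  have "linear (\<lambda>X. K ** X ** dagger K)"
    by (rule linearI) (simp_all add: cmatrix_algebra algebra_simps)
  then have R: "endo_apply R X = K ** X ** dagger K" for X
    by (simp add: R_def endo_apply_endo_of)
  have "flow (lindblad K V) t X \<in> {A. pos_semidefinite A}"
  proof (rule flow_mem_closed[where R = R])
    fix h :: real and X :: "'d cmatrix"
    assume h: "0 \<le> h" and "X \<in> {A. pos_semidefinite A}"
    then have "pos_semidefinite ((mat 1 + h *\<^sub>R K) ** X ** dagger (mat 1 + h *\<^sub>R K)
        + h *\<^sub>R (V ** X ** dagger V))"
      by (intro pos_semidefinite_add pos_semidefinite_sandwich pos_semidefinite_scaleR) auto
    also have "(mat 1 + h *\<^sub>R K) ** X ** dagger (mat 1 + h *\<^sub>R K) + h *\<^sub>R (V ** X ** dagger V)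
        = X + h *\<^sub>R endo_apply (lindblad K V) X + (h * h) *\<^sub>R endo_apply R X"
      by (simp add: lindblad_apply R dagger_add dagger_scaleR cmatrix_algebra algebra_simps)
    finally show "X + h *\<^sub>R endo_apply (lindblad K V) X + (h * h) *\<^sub>R endo_apply R X
        \<in> {A. pos_semidefinite A}" by simp
  qed (use assms closed_pos_semidefinite in auto)
  then show ?thesis by simp
qed

lemma trace_flow_lindblad:
  fixes K V :: "'d::finite cmatrix"
  assumes KV: "K + dagger K + dagger V ** V = 0"
  shows "trace (flow (lindblad K V) t X) = trace X"
proof -
  have tr0: "trace (endo_apply (lindblad K V) Y) = 0" for Y
  proof -
    have "trace (endo_apply (lindblad K V) Y) = trace ((K + dagger K + dagger V ** V) ** Y)"
      using trace_mul_sym[of Y "dagger K"] trace_mul_sym[of "V ** Y" "dagger V"]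
      by (simp add: lindblad_apply cmatrix_algebra trace_add)
    then show ?thesis by (simp add: KV trace_def)
  qed
  have "((\<lambda>t. trace (flow (lindblad K V) t X)) has_vector_derivative
      trace (endo_apply (lindblad K V) (flow (lindblad K V) t X))) (at t within UNIV)" for t
    by (intro bounded_linear.has_vector_derivative[OF linear_trace[unfolded linear_conv_bounded_linear]]
        flow_has_vector_derivative)
  then obtain c where c: "\<And>t. trace (flow (lindblad K V) t X) = c"
    using has_vector_derivative_zero_constant[of UNIV "\<lambda>t. trace (flow (lindblad K V) t X)"]
    by (auto simp: tr0)
  then show ?thesis using c[of 0] by simp
qed

lemma flow_lindblad_density:
  assumes "K + dagger K + dagger V ** V = 0" "X \<in> density_matrices" "0 \<le> t"
  shows "flow (lindblad K V) t X \<in> density_matrices"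
  using assms flow_lindblad_pos_semidefinite[of X t K V]
  by (simp add: density_matrices_def trace_flow_lindblad)

section \<open>Permutations and diagonalization by unitary flows\<close>

definition unit_mat :: "'d \<Rightarrow> 'd \<Rightarrow> 'd::finite cmatrix" where
  "unit_mat i j = (\<chi> a b. if a = i \<and> b = j then 1 else 0)"

lemma unit_mat_mult_left: "(unit_mat i j ** B) $ a $ b = (if a = i then B $ j $ b else 0)"
proof -
  have "(unit_mat i j ** B) $ a $ b = (\<Sum>k\<in>UNIV. if k = j then (if a = i then B $ j $ b else 0) else 0)"
    unfolding matrix_mult_nth by (rule sum.cong) (auto simp: unit_mat_def)
  then show ?thesis by simp
qed

lemma unit_mat_mult_right: "(B ** unit_mat i j) $ a $ b = (if b = j then B $ a $ i else 0)"
proof -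
  have "(B ** unit_mat i j) $ a $ b = (\<Sum>k\<in>UNIV. if k = i then (if b = j then B $ a $ i else 0) else 0)"
    unfolding matrix_mult_nth by (rule sum.cong) (auto simp: unit_mat_def)
  then show ?thesis by simp
qed

lemma cscale_mult_left: "cscale c A ** B = cscale c (A ** B)"
  by (simp add: vec_eq_iff matrix_mult_nth sum_distrib_left mult_ac)

lemma cscale_mult_right: "A ** cscale c B = cscale c (A ** B)"
  by (simp add: vec_eq_iff matrix_mult_nth sum_distrib_left mult_ac)

text \<open>z = 1 gives the real rotation of the coordinates i and j; the free phase lets the first
  variation of the energy detect a complex off-diagonal entry.\<close>

definition skew_pair :: "'d \<Rightarrow> 'd \<Rightarrow> complex \<Rightarrow> 'd::finite cmatrix" where
  "skew_pair i j z = cscale z (unit_mat i j) - cscale (cnj z) (unit_mat j i)"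

lemma skew_pair_mem_su: "i \<noteq> j \<Longrightarrow> skew_pair i j z \<in> su"
  by (auto simp: su_def skew_pair_def vec_eq_iff unit_mat_def trace_def intro!: sum.neutral)

lemma suD: "A \<in> su \<Longrightarrow> dagger A = - A"
  by (simp add: su_def)

lemma ad_skew_pair_nth:
  "endo_apply (ad (skew_pair i j z)) X $ a $ b =
     (if a = i then z * X $ j $ b else 0) - (if a = j then cnj z * X $ i $ b else 0)
     - (if b = j then z * X $ a $ i else 0) + (if b = i then cnj z * X $ a $ j else 0)"
  by (simp add: ad_apply skew_pair_def cmatrix_algebra cscale_mult_left cscale_mult_right
      unit_mat_mult_left unit_mat_mult_right)

lemma diag_of_nth [simp]: "diag_of x $ i $ j = (if i = j then of_real (x $ i) else 0)"
  by (simp add: diag_of_def)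

text \<open>A quarter turn of a coordinate plane. The diagonal matrix, \<open>M\<close> and
  \<open>Q\<close> span an invariant space on which the solution is explicit. The angle is doubled
  there, so at pi/2 the factor cos (2t) - 1 is -2, and subtracting 2 c \<open>M\<close> exchanges
  the two entries.\<close>

lemma flow_swap:
  fixes x :: "real^'d::finite"
  assumes "i \<noteq> j"
  shows "flow (ad (skew_pair i j 1)) (pi / 2) (diag_of x) = diag_of (\<chi> k. x $ Transposition.transpose i j k)"
proof -
  define c where "c = (x $ i - x $ j) / 2"
  define M where "M = (unit_mat i i - unit_mat j j :: 'd cmatrix)"
  define Q where "Q = (unit_mat i j + unit_mat j i :: 'd cmatrix)"
  define Y where "Y t = diag_of x + (c * (cos (2 * t) - 1)) *\<^sub>R M - (c * sin (2 * t)) *\<^sub>R Q" for t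
  let ?L = "ad (skew_pair i j 1)"
  have x: "endo_apply ?L (diag_of x) = - (2 * c) *\<^sub>R Q"
    using assms
    by (simp add: vec_eq_iff ad_skew_pair_nth Q_def unit_mat_def c_def complex_eq_iff)
       (auto simp: field_simps)
  have M: "endo_apply ?L M = - 2 *\<^sub>R Q"
    using assms by (simp add: vec_eq_iff ad_skew_pair_nth Q_def M_def unit_mat_def complex_eq_iff)
  have Q: "endo_apply ?L Q = 2 *\<^sub>R M"
    using assms by (simp add: vec_eq_iff ad_skew_pair_nth Q_def M_def unit_mat_def complex_eq_iff)
  have "(Y has_vector_derivative endo_apply ?L (Y t)) (at t)" for t
  proof -
    have "(Y has_vector_derivative (c * (- sin (2 * t) * 2)) *\<^sub>R M - (c * (cos (2 * t) * 2)) *\<^sub>R Q) (at t)"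
      unfolding Y_def by (auto intro!: derivative_eq_intros simp: algebra_simps)
    also have "(c * (- sin (2 * t) * 2)) *\<^sub>R M - (c * (cos (2 * t) * 2)) *\<^sub>R Q = endo_apply ?L (Y t)"
      by (simp add: Y_def endo.add_right endo.diff_right endo.scaleR_right x M Q algebra_simps)
    finally show ?thesis .
  qed
  then have "Y (pi / 2) = flow ?L (pi / 2) (Y 0)"
    by (intro flow_unique') auto
  moreover have "Y 0 = diag_of x" by (simp add: Y_def)
  moreover have "Y (pi / 2) = diag_of (\<chi> k. x $ Transposition.transpose i j k)"
    using assms
    by (auto simp: Y_def vec_eq_iff c_def M_def Q_def unit_mat_def complex_eq_iff
        Transposition.transpose_def field_simps)
  ultimately show ?thesis by simp
qed

text \<open>A one-sided first order condition: only forward times are compared, so it serves the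
  dissipative semigroup as well as unitary groups.\<close>

lemma linear_functional_flow_ge:
  fixes E :: "'a::euclidean_space \<Rightarrow> real"
  assumes E: "linear E" and min: "\<And>t. 0 \<le> t \<Longrightarrow> E X \<le> E (flow L t X)"
  shows "0 \<le> E (endo_apply L X)"
proof -
  have "((\<lambda>t. E (flow L t X)) has_vector_derivative E (endo_apply L (flow L 0 X))) (at 0 within {0..})"
    by (intro bounded_linear.has_vector_derivative[OF E[unfolded linear_conv_bounded_linear]]
        flow_has_vector_derivative)
  then have "((\<lambda>t. (E (flow L t X) - E X) /\<^sub>R t) \<longlongrightarrow> E (endo_apply L X)) (at 0 within {0..})"
    by (auto dest: has_vector_derivative_imp_quotient_tendsto)
  then show ?thesis
    by (rule tendsto_lowerbound)
       (auto simp: eventually_at_filter min at_within_Ici_at_right intro!: always_eventually)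
qed

definition energy :: "('d \<Rightarrow> nat) \<Rightarrow> 'd::finite cmatrix \<Rightarrow> real" where
  "energy pos X = (\<Sum>i\<in>UNIV. real (pos i) * Re (X $ i $ i))"

lemma linear_energy: "linear (energy pos)"
  by (rule linearI) (simp_all add: energy_def algebra_simps sum.distrib sum_distrib_left)

lemma energy_ad_skew_pair:
  assumes "i \<noteq> j" "dagger X = X"
  shows "energy pos (endo_apply (ad (skew_pair i j z)) X)
    = 2 * ((real (pos i) - real (pos j)) * Re (z * X $ j $ i))"
proof -
  have ij: "X $ i $ j = cnj (X $ j $ i)" using assms(2) by (metis dagger_nth)
  have "energy pos (endo_apply (ad (skew_pair i j z)) X)
    = (\<Sum>k\<in>UNIV. (if k = i then real (pos i) * (2 * Re (z * X $ j $ i)) else 0)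
        - (if k = j then real (pos j) * (2 * Re (z * X $ j $ i)) else 0))"
    unfolding energy_def ad_skew_pair_nth using assms(1)
    by (intro sum.cong) (auto simp: ij algebra_simps)
  also have "\<dots> = 2 * ((real (pos i) - real (pos j)) * Re (z * X $ j $ i))"
    by (simp add: sum_subtractf algebra_simps)
  finally show ?thesis .
qed

text \<open>Critical points of \<open>energy\<close> on a unitary orbit are diagonal (Brockett); at a minimum the
  diagonal is moreover sorted, since otherwise a transposition would lower the energy.\<close>

lemma energy_minimizer:
  fixes W :: "'d::finite cmatrix set"
  assumes W: "compact W" "W \<noteq> {}" "W \<subseteq> density_matrices"
    and inv: "\<And>A t X. A \<in> su \<Longrightarrow> X \<in> W \<Longrightarrow> flow (ad A) t X \<in> W"
    and pos: "inj pos"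
  obtains x where "diag_of x \<in> W" "\<And>X. X \<in> W \<Longrightarrow> energy pos (diag_of x) \<le> energy pos X"
    "\<And>i j. pos i < pos j \<Longrightarrow> x $ j \<le> x $ i"
proof -
  have "continuous_on W (energy pos)"
    by (intro linear_continuous_on linear_energy[unfolded linear_conv_bounded_linear])
  then obtain X where X: "X \<in> W" and min: "\<And>Y. Y \<in> W \<Longrightarrow> energy pos X \<le> energy pos Y"
    using continuous_attains_inf[OF W(1,2)] by blast
  have psd: "pos_semidefinite X" using X W(3) by (auto simp: density_matrices_def)
  then have herm: "dagger X = X" by (simp add: pos_semidefinite_iff)
  have off: "X $ j $ i = 0" if "i \<noteq> j" for i j
  proof -
    have ge: "0 \<le> (real (pos i) - real (pos j)) * Re (z * X $ j $ i)" for z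
      using linear_functional_flow_ge[OF linear_energy, of pos X "ad (skew_pair i j z)"]
        min inv X skew_pair_mem_su[OF that] energy_ad_skew_pair[OF that herm] by simp
    have ne: "real (pos i) - real (pos j) \<noteq> 0" using that pos by (auto dest: injD)
    \<comment> \<open>The two choices of z give both signs of the squared modulus, so the inequality
      for all z becomes an equation.\<close>
    have "(real (pos i) - real (pos j)) * Re (cnj (X $ j $ i) * X $ j $ i) = 0"
      using ge[of "cnj (X $ j $ i)"] ge[of "- cnj (X $ j $ i)"] by (simp add: algebra_simps)
    then have "Re (cnj (X $ j $ i) * X $ j $ i) = 0" using ne by simp
    then show ?thesis by (simp add: complex_eq_iff)
  qed
  define x where "x = (\<chi> i. Re (X $ i $ i))"
  have Xx: "X = diag_of x"
    using off density_diag_nonneg(2)[OF psd] by (simp add: vec_eq_iff x_def complex_eq_iff)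
  have sorted: "x $ j \<le> x $ i" if "pos i < pos j" for i j
  proof -
    have ij: "i \<noteq> j" using that by auto
    let ?y = "\<chi> k. x $ Transposition.transpose i j k"
    have "diag_of ?y \<in> W"
      using inv[OF skew_pair_mem_su[OF ij, of 1] X, of "pi / 2"] by (simp add: Xx flow_swap[OF ij])
    then have "energy pos X \<le> energy pos (diag_of ?y)" by (rule min)
    moreover have "energy pos (diag_of ?y) - energy pos X
      = (\<Sum>k\<in>UNIV. (if k = i then real (pos i) * (x $ j - x $ i) else 0)
          + (if k = j then real (pos j) * (x $ i - x $ j) else 0))"
      unfolding energy_def Xx sum_subtractf[symmetric] using ij
      by (intro sum.cong) (auto simp: Transposition.transpose_def algebra_simps)
    ultimately have "0 \<le> real (pos i) * (x $ j - x $ i) + real (pos j) * (x $ i - x $ j)"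
      by (simp add: sum.distrib)
    then have "0 \<le> (real (pos j) - real (pos i)) * (x $ i - x $ j)"
      by (simp add: algebra_simps)
    then show ?thesis using that by (simp add: zero_le_mult_iff)
  qed
  show ?thesis
    using that[of x] X min sorted unfolding Xx by blast
qed

lemma flow_ad_density:
  assumes A: "dagger A = - A" and X: "X \<in> density_matrices"
  shows "flow (ad A) t X \<in> density_matrices"
proof (cases "0 \<le> t")
  case True
  then show ?thesis
    using X A by (simp add: ad_eq_lindblad flow_lindblad_density)
next
  case False
  have "flow (ad A) t X = flow (ad (- A)) (- t) X"
    by (simp add: flow_def linear_neg[OF linear_ad])
  moreover have "flow (ad (- A)) (- t) X \<in> density_matrices"
    using X A False by (simp add: ad_eq_lindblad dagger_minus flow_lindblad_density)
  ultimately show ?thesis by simp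
qed

section \<open>Decay towards the ground state\<close>

text \<open>\<open>t\<close> is the least time at which some \<open>f i\<close> is nonpositive. A
  negative value there would force, by the intermediate value theorem, a zero at an earlier
  time.\<close>

lemma exists_first_zero:
  fixes f :: "'i \<Rightarrow> real \<Rightarrow> real"
  assumes S: "finite S" and T: "0 \<le> T"
    and cont: "\<And>i. i \<in> S \<Longrightarrow> continuous_on {0..T} (f i)"
    and f0: "\<And>i. i \<in> S \<Longrightarrow> 0 < f i 0"
    and j: "j \<in> S" "f j T \<le> 0"
  obtains t where "0 \<le> t" "\<And>i. i \<in> S \<Longrightarrow> 0 \<le> f i t" "\<exists>i\<in>S. f i t = 0"
proof -
  define Z where "Z = (\<Union>i\<in>S. {0..T} \<inter> f i -` {..0})"
  have "closed ({0..T} \<inter> f i -` {..0})" if "i \<in> S" for i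
    using continuous_on_closed_vimage[of "{0..T}" "f i"] cont[OF that] by (simp add: Int_commute)
  then have "closed Z" unfolding Z_def using S by (intro closed_UN) auto
  moreover have "bounded Z" by (rule bounded_subset[of "{0..T}"]) (auto simp: Z_def)
  ultimately have "compact Z" by (simp add: compact_eq_bounded_closed)
  moreover have "T \<in> Z" using j T by (auto simp: Z_def)
  ultimately obtain t where t: "t \<in> Z" "\<And>s. s \<in> Z \<Longrightarrow> t \<le> s"
    using compact_attains_inf[of Z] by blast
  have tT: "0 \<le> t" "t \<le> T" using t(1) by (auto simp: Z_def)
  have nonneg: "0 \<le> f i t" if i: "i \<in> S" for i
  proof (rule ccontr)
    assume "\<not> 0 \<le> f i t"
    moreover have "continuous_on {0..t} (f i)"
      using tT by (intro continuous_on_subset[OF cont[OF i]]) auto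
    ultimately obtain s where s: "0 \<le> s" "s \<le> t" "f i s = 0"
      using IVT2'[of "f i" t 0 0] f0[OF i] tT by force
    then have "s \<in> Z" using tT i unfolding Z_def by (intro UN_I[of i]) auto
    then have "s = t" using t(2) s(2) by force
    then show False using s(3) \<open>\<not> 0 \<le> f i t\<close> by simp
  qed
  obtain i where "i \<in> S" "f i t \<le> 0" using t(1) by (auto simp: Z_def)
  then have "\<exists>i\<in>S. f i t = 0" using nonneg by force
  then show ?thesis using that tT(1) nonneg by blast
qed

lemma diag_of_mem_density_iff:
  "diag_of x \<in> density_matrices \<longleftrightarrow> (\<forall>i. 0 \<le> x $ i) \<and> (\<Sum>i\<in>UNIV. x $ i) = 1"
proof -
  have tr: "trace (diag_of x) = of_real (\<Sum>i\<in>UNIV. x $ i)"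
    by (simp add: trace_def)
  have "(diag_of x *v v) $ i = of_real (x $ i) * v $ i" for v i
    by (simp add: matrix_vector_mult_def if_distrib[of "\<lambda>y. y * _"] cong: if_cong)
  then have "cdot v (diag_of x *v v) = (\<Sum>i\<in>UNIV. of_real (x $ i * (norm (v $ i))\<^sup>2))" for v
    by (simp add: cdot_def complex_norm_square mult_ac del: of_real_power)
  then have "pos_semidefinite (diag_of x)" if "\<forall>i. 0 \<le> x $ i"
    using that by (auto simp: pos_semidefinite_iff vec_eq_iff intro!: sum_nonneg)
  moreover have "0 \<le> x $ i" if "pos_semidefinite (diag_of x)" for i
    using density_diag_nonneg(1)[OF that, of i] by simp
  moreover have "trace (diag_of x) = 1 \<longleftrightarrow> (\<Sum>i\<in>UNIV. x $ i) = 1"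
    unfolding tr using of_real_eq_1_iff by blast
  ultimately show ?thesis by (auto simp: density_matrices_def)
qed

text \<open>On diagonal states \<open>L\<close> is a pure death process: level q loses population to
  level q - 1 at rate g (c q)^2. Coefficients above level 1 may vanish, as they do between the
  blocks of the local operator. \<open>C\<close> stands for the closure of the reachable
  set.\<close>

locale decay =
  fixes pos :: "'d::finite \<Rightarrow> nat" and c :: "nat \<Rightarrow> real" and g :: real
    and L :: "'d cmatrix endo" and C :: "'d cmatrix set"
  assumes bij: "bij_betw pos UNIV {..<CARD('d)}"
    and c0: "c 0 = 0" and c1: "1 < CARD('d) \<Longrightarrow> c 1 \<noteq> 0" and g: "0 < g"
    and L_diag: "endo_apply L (diag_of x) = diag_of (\<chi> i. g *
      ((\<Sum>k\<in>UNIV. if pos k = Suc (pos i) then (c (pos k))\<^sup>2 * x $ k else 0) - (c (pos i))\<^sup>2 * x $ i))"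
    and trace_flow: "trace (flow L t X) = trace X"
    and C: "closed C" "C \<noteq> {}" "C \<subseteq> density_matrices"
    and ad_C: "A \<in> su \<Longrightarrow> X \<in> C \<Longrightarrow> flow (ad A) t X \<in> C"
    and L_C: "0 \<le> t \<Longrightarrow> X \<in> C \<Longrightarrow> flow L t X \<in> C"
begin

lemma inj_pos: "inj pos"
  using bij by (simp add: bij_betw_def)

lemma pos_surj: "q < CARD('d) \<Longrightarrow> \<exists>i. pos i = q"
  using bij by (metis bij_betw_def imageE lessThan_iff)

lemma pos_less: "pos i < CARD('d)"
  using bij by (auto simp: bij_betw_def)

lemma compact_C: "compact C"
  using compact_density_matrices C by (metis compact_Int_closed inf.absorb_iff2)

text \<open>Every jump lowers the energy by exactly one, so the rate of loss is the total jump
  rate.\<close>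

lemma energy_L_diag:
  "energy pos (endo_apply L (diag_of x)) = - g * (\<Sum>i\<in>UNIV. (c (pos i))\<^sup>2 * x $ i)"
proof -
  have "(\<Sum>i\<in>UNIV. real (pos i) * (\<Sum>k\<in>UNIV. if pos k = Suc (pos i) then (c (pos k))\<^sup>2 * x $ k else 0))
    = (\<Sum>k\<in>UNIV. \<Sum>i\<in>UNIV. if pos k = Suc (pos i) then real (pos i) * ((c (pos k))\<^sup>2 * x $ k) else 0)"
    unfolding sum_distrib_left
    by (subst sum.swap) (auto intro!: sum.cong)
  \<comment> \<open>Indexed by the source level, a jump contributes pos k - 1. At the ground level
    this reads -1, but \<open>c 0 = 0\<close> removes the term.\<close>
  also have "\<dots> = (\<Sum>k\<in>UNIV. (real (pos k) - 1) * ((c (pos k))\<^sup>2 * x $ k))"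
  proof (rule sum.cong[OF refl])
    fix k
    show "(\<Sum>i\<in>UNIV. if pos k = Suc (pos i) then real (pos i) * ((c (pos k))\<^sup>2 * x $ k) else 0)
      = (real (pos k) - 1) * ((c (pos k))\<^sup>2 * x $ k)"
    proof (cases "pos k")
      case 0
      then show ?thesis by (simp add: c0)
    next
      case (Suc q)
      then obtain p where p: "pos p = q" using pos_surj pos_less[of k] by (metis Suc_lessD)
      have "(pos k = Suc (pos i)) = (i = p)" for i
        using Suc p inj_pos by (auto dest: injD)
      then show ?thesis by (simp add: Suc p)
    qed
  qed
  finally have *: "(\<Sum>i\<in>UNIV. real (pos i) * (\<Sum>k\<in>UNIV. if pos k = Suc (pos i) then (c (pos k))\<^sup>2 * x $ k else 0))
    = (\<Sum>k\<in>UNIV. (real (pos k) - 1) * ((c (pos k))\<^sup>2 * x $ k))" .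
  have "energy pos (endo_apply L (diag_of x))
    = g * ((\<Sum>i\<in>UNIV. real (pos i) * (\<Sum>k\<in>UNIV. if pos k = Suc (pos i) then (c (pos k))\<^sup>2 * x $ k else 0))
        - (\<Sum>i\<in>UNIV. real (pos i) * ((c (pos i))\<^sup>2 * x $ i)))"
    by (simp add: energy_def L_diag sum_subtractf[symmetric] sum_distrib_left algebra_simps)
  also have "\<dots> = - g * (\<Sum>i\<in>UNIV. (c (pos i))\<^sup>2 * x $ i)"
    unfolding * sum_subtractf[symmetric] by (simp add: algebra_simps sum_negf)
  finally show ?thesis .
qed

text \<open>Minimality under decay only empties the levels with nonzero coefficient. Level 1 is one
  of them if it exists, and since populations are sorted, all higher levels are then empty too,
  including those with zero coefficient.\<close>

lemma ground_state_mem: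
  assumes i0: "pos i0 = 0"
  shows "diag_of (axis i0 1) \<in> C"
proof -
  obtain x where x: "diag_of x \<in> C" and min: "\<And>X. X \<in> C \<Longrightarrow> energy pos (diag_of x) \<le> energy pos X"
    and sorted: "\<And>i j. pos i < pos j \<Longrightarrow> x $ j \<le> x $ i"
    using energy_minimizer[OF compact_C C(2,3) ad_C inj_pos] by metis
  have x_density: "\<And>i. 0 \<le> x $ i" "(\<Sum>i\<in>UNIV. x $ i) = 1"
    using x C(3) diag_of_mem_density_iff[of x] by auto
  have "0 \<le> energy pos (endo_apply L (diag_of x))"
    using L_C x min by (intro linear_functional_flow_ge linear_energy) auto
  then have "(\<Sum>i\<in>UNIV. (c (pos i))\<^sup>2 * x $ i) \<le> 0"
    using g by (simp add: energy_L_diag mult_le_0_iff)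
  moreover have "0 \<le> (\<Sum>i\<in>UNIV. (c (pos i))\<^sup>2 * x $ i)"
    using x_density by (intro sum_nonneg) auto
  ultimately have dark: "(c (pos i))\<^sup>2 * x $ i = 0" for i
    using sum_nonneg_eq_0_iff[of UNIV "\<lambda>i. (c (pos i))\<^sup>2 * x $ i"] x_density by auto
  have zero: "x $ i = 0" if "i \<noteq> i0" for i
  proof -
    have "pos i \<noteq> 0" using that i0 inj_pos by (metis injD)
    then have "1 < CARD('d)" using pos_less[of i] by linarith
    then obtain i1 where i1: "pos i1 = 1" using pos_surj by blast
    then have "x $ i1 = 0" using dark[of i1] c1 \<open>1 < CARD('d)\<close> by simp
    moreover have "x $ i \<le> x $ i1"
    proof (cases "i = i1")
      case False
      then have "pos i1 < pos i" using i1 \<open>pos i \<noteq> 0\<close> inj_pos by (metis One_nat_def Suc_lessI gr0I injD)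
      then show ?thesis by (rule sorted)
    qed simp
    ultimately show ?thesis using x_density(1)[of i] by simp
  qed
  have "(\<Sum>i\<in>UNIV. x $ i) = (\<Sum>i\<in>UNIV. if i = i0 then x $ i0 else 0)"
    by (rule sum.cong) (auto simp: zero)
  then have "x $ i0 = 1" using x_density(2) by simp
  then have "x = axis i0 1" by (auto simp: vec_eq_iff axis_def zero)
  then show ?thesis using x by simp
qed

text \<open>Run the decay backwards from \<open>diag_of x\<close>: the highest occupied level that can decay grows
  exponentially, so by conservation of the trace some population has to vanish.\<close>

lemma backward_decay:
  assumes x: "\<And>i. 0 \<le> x $ i" "(\<Sum>i\<in>UNIV. x $ i) = 1"
    and down: "\<And>i j. pos i \<le> pos j \<Longrightarrow> x $ j \<noteq> 0 \<Longrightarrow> x $ i \<noteq> 0"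
    and excited: "x $ i1 \<noteq> 0" "pos i1 = 1"
  obtains t z where "0 \<le> t" "diag_of x = flow L t (diag_of z)"
    "\<And>i. 0 \<le> z $ i" "(\<Sum>i\<in>UNIV. z $ i) = 1" "{i. z $ i \<noteq> 0} \<subset> {i. x $ i \<noteq> 0}"
proof -
  define S where "S = {i. x $ i \<noteq> 0}"
  define y where "y t = flow L (- t) (diag_of x)" for t
  define z where "z t = (\<chi> i. Re (y t $ i $ i))" for t
  \<comment> \<open>The support has no gaps and jumps only go down, so the diagonal matrices
    supported in \<open>S\<close> form an \<open>L\<close>-invariant subspace, which the flow
    preserves in both time directions.\<close>
  define W where "W = {diag_of w | w. \<forall>i. i \<notin> S \<longrightarrow> w $ i = 0}"
  have W: "diag_of w \<in> W \<longleftrightarrow> (\<forall>i. i \<notin> S \<longrightarrow> w $ i = 0)" for w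
  proof
    assume "diag_of w \<in> W"
    then obtain w' where "diag_of w = diag_of w'" "\<forall>i. i \<notin> S \<longrightarrow> w' $ i = 0" by (auto simp: W_def)
    moreover have "w = w'" if "diag_of w = diag_of w'"
      using that by (simp add: vec_eq_iff) (metis of_real_eq_iff)
    ultimately show "\<forall>i. i \<notin> S \<longrightarrow> w $ i = 0" by blast
  qed (auto simp: W_def)
  have diag_add: "diag_of v + diag_of w = diag_of (v + w)" for v w :: "real^'d"
    by (simp add: vec_eq_iff)
  have diag_scaleR: "a *\<^sub>R diag_of w = diag_of (a *\<^sub>R w)" for a and w :: "real^'d"
    by (simp add: vec_eq_iff complex_eq_iff)
  have "subspace W"
    unfolding subspace_def
  proof (intro conjI ballI allI)
    have "diag_of 0 \<in> W" by (simp add: W)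
    moreover have "diag_of 0 = (0 :: 'd cmatrix)" by (simp add: vec_eq_iff)
    ultimately show "0 \<in> W" by simp
  next
    fix X Y assume "X \<in> W" "Y \<in> W"
    then obtain v w where "X = diag_of v" "Y = diag_of w"
      "\<forall>i. i \<notin> S \<longrightarrow> v $ i = 0" "\<forall>i. i \<notin> S \<longrightarrow> w $ i = 0"
      by (auto simp: W_def)
    then show "X + Y \<in> W" by (simp add: diag_add W)
  next
    fix X and a :: real assume "X \<in> W"
    then obtain w where "X = diag_of w" "\<forall>i. i \<notin> S \<longrightarrow> w $ i = 0"
      by (auto simp: W_def)
    then show "a *\<^sub>R X \<in> W" by (simp add: diag_scaleR W)
  qed
  have LW: "endo_apply L X \<in> W" if X: "X \<in> W" for X
  proof -
    obtain w where w: "X = diag_of w" "\<And>i. i \<notin> S \<Longrightarrow> w $ i = 0" using X by (auto simp: W_def)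
    have "k \<notin> S" if "i \<notin> S" "pos k = Suc (pos i)" for i k
      using that down[of i k] by (auto simp: S_def)
    then show ?thesis
      by (auto simp: w L_diag W intro!: sum.neutral)
  qed
  have yW: "y t \<in> W" if "0 \<le> t" for t
  proof -
    have "flow (- L) t (diag_of x) \<in> W"
    proof (rule flow_mem_closed[where R = 0])
      show "closed W" using \<open>subspace W\<close> by (rule closed_subspace)
      show "diag_of x \<in> W" by (simp add: W S_def)
      show "X + h *\<^sub>R endo_apply (- L) X + (h * h) *\<^sub>R endo_apply 0 X \<in> W" if "X \<in> W" for h X
        using that \<open>subspace W\<close> LW
        by (auto simp: endo.minus_left endo.zero_left intro!: subspace_diff subspace_scale)
    qed fact
    then show ?thesis by (simp add: y_def flow_def)
  qed
  have yz: "y t = diag_of (z t)" and zS: "i \<notin> S \<Longrightarrow> z t $ i = 0" if t: "0 \<le> t" for t i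
  proof -
    obtain w where w: "y t = diag_of w" "\<And>i. i \<notin> S \<Longrightarrow> w $ i = 0"
      using yW[OF t] by (auto simp: W_def)
    moreover have "z t = w" by (simp add: z_def w vec_eq_iff)
    ultimately show "y t = diag_of (z t)" "i \<notin> S \<Longrightarrow> z t $ i = 0" by auto
  qed
  have z0: "z 0 = x" by (simp add: z_def y_def vec_eq_iff)
  have sum_z: "(\<Sum>i\<in>UNIV. z t $ i) = 1" if "0 \<le> t" for t
  proof -
    have "trace (y t) = trace (diag_of x)" by (simp add: y_def trace_flow)
    then have "Re (trace (y t)) = (\<Sum>i\<in>UNIV. x $ i)" by (simp add: trace_def)
    then show ?thesis using x by (simp add: z_def trace_def)
  qed
  have deriv: "((\<lambda>t. z t $ i) has_real_derivative - Re (endo_apply L (y t) $ i $ i)) (at t within A)" for i t A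
  proof -
    have "((\<lambda>t. flow (- L) t (diag_of x)) has_vector_derivative endo_apply (- L) (flow (- L) t (diag_of x)))
        (at t within A)"
      by (rule flow_has_vector_derivative)
    then have "(y has_vector_derivative - endo_apply L (y t)) (at t within A)"
      by (simp add: y_def[abs_def] flow_def endo.minus_left)
    then have "((\<lambda>t. Re (y t $ i $ i)) has_vector_derivative Re ((- endo_apply L (y t)) $ i $ i)) (at t within A)"
      by (intro bounded_linear.has_vector_derivative[OF bounded_linear_Re]
          bounded_linear.has_vector_derivative[OF bounded_linear_vec_nth])
    then show ?thesis by (simp add: z_def has_real_derivative_iff_has_vector_derivative)
  qed
  \<comment> \<open>The levels of \<open>S\<close> that decay; \<open>i1\<close> is one of them.
    Nothing feeds the highest, \<open>j\<close>: the level above it is unoccupied or has zero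
    coefficient. So the population of \<open>j\<close> obeys a scalar linear equation.\<close>
  define P where "P = {i \<in> S. c (pos i) \<noteq> 0}"
  have "i1 \<in> P"
    using excited c1 pos_less[of i1] by (simp add: P_def S_def)
  then obtain j where j: "j \<in> P" "\<And>i. i \<in> P \<Longrightarrow> pos i \<le> pos j"
    using obtains_MAX[of P pos] Max_ge[of "pos ` P"] by (metis empty_iff finite finite_imageI imageI)
  define a where "a = g * (c (pos j))\<^sup>2"
  have a: "0 < a" using j g by (simp add: a_def P_def)
  have L_j: "- Re (endo_apply L (y t) $ j $ j) = a * z t $ j" if "0 \<le> t" for t
  proof -
    have "(c (pos k))\<^sup>2 * z t $ k = 0" if "pos k = Suc (pos j)" for k
      using that j(2)[of k] zS[OF \<open>0 \<le> t\<close>, of k] by (auto simp: P_def)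
    then have "(\<Sum>k\<in>UNIV. if pos k = Suc (pos j) then (c (pos k))\<^sup>2 * z t $ k else 0) = 0"
      by (intro sum.neutral) auto
    then show ?thesis by (simp add: yz[OF that] L_diag a_def)
  qed
  have growth: "z t $ j = exp (a * t) * x $ j" if "0 \<le> t" for t
  proof -
    have "exp (- a * t) * z t $ j = exp (- a * 0) * z 0 $ j"
    proof (cases "t = 0")
      case False
      have "((\<lambda>s. exp (- a * s) * z s $ j) has_real_derivative 0) (at s within A)" if "0 \<le> s" for s A
      proof -
        have "((\<lambda>s. exp (- a * s) * z s $ j) has_real_derivative
            exp (- a * s) * (- Re (endo_apply L (y s) $ j $ j)) + exp (- a * s) * (- a) * z s $ j) (at s within A)"
          by (rule DERIV_mult'[OF _ deriv]) (auto intro!: derivative_eq_intros)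
        then show ?thesis unfolding L_j[OF that] by (simp add: algebra_simps)
      qed
      then show ?thesis
        using that False
        by (intro DERIV_isconst2[of 0 t] DERIV_continuous_on[where D = "\<lambda>_. 0"]) auto
    qed simp
    then show ?thesis by (simp add: z0 exp_minus field_simps)
  qed
  have xj: "0 < x $ j" using j x(1)[of j] by (simp add: P_def S_def)
  \<comment> \<open>Makes a T x_j equal to 2, so that exp (a T) x_j exceeds 1, the conserved
    total.\<close>
  define T where "T = 2 / (a * x $ j)"
  have T: "0 < T" using a xj by (simp add: T_def)
  have "1 < z T $ j"
  proof -
    have "1 < (a * T) * x $ j" using a xj by (simp add: T_def)
    also have "\<dots> \<le> exp (a * T) * x $ j"
      using exp_ge_add_one_self[of "a * T"] xj by (intro mult_right_mono) linarith+
    finally show ?thesis using growth[of T] T by simp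
  qed
  have "\<exists>i\<in>S. z T $ i \<le> 0"
  proof (rule ccontr)
    assume "\<not> (\<exists>i\<in>S. z T $ i \<le> 0)"
    then have "0 \<le> z T $ i" for i using zS[of T i] T by (cases "i \<in> S") force+
    then have "z T $ j \<le> (\<Sum>i\<in>UNIV. z T $ i)" by (intro member_le_sum) auto
    then show False using \<open>1 < z T $ j\<close> sum_z[of T] T by simp
  qed
  then obtain i where i: "i \<in> S" "z T $ i \<le> 0" by blast
  have cont: "continuous_on {0..T} (\<lambda>t. z t $ k)" for k
    by (rule DERIV_continuous_on) (rule deriv)
  have z0_pos: "0 < z 0 $ k" if "k \<in> S" for k
    using that x(1)[of k] by (simp add: z0 S_def)
  obtain t where t: "0 \<le> t" "\<And>i. i \<in> S \<Longrightarrow> 0 \<le> z t $ i" "\<exists>i\<in>S. z t $ i = 0"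
    using exists_first_zero[of S T "\<lambda>i t. z t $ i", OF _ _ cont z0_pos i] T by auto
  show ?thesis
  proof (rule that[of t "z t"])
    show "diag_of x = flow L t (diag_of (z t))"
      unfolding yz[OF t(1), symmetric] by (simp add: y_def)
    show "0 \<le> z t $ i" for i using t(2)[of i] zS[OF t(1), of i] by (cases "i \<in> S") auto
    show "{i. z t $ i \<noteq> 0} \<subset> {i. x $ i \<noteq> 0}"
      using zS[OF t(1)] t(3) by (force simp: S_def)
  qed (use t sum_z in auto)
qed

text \<open>A gap below an occupied level is closed by a transposition, and the same transposition
  leads back to the original state. A gap-free support other than the ground level is handled by a
  predecessor with smaller support.\<close>

lemma diag_density_mem:
  assumes "\<And>i. 0 \<le> x $ i" "(\<Sum>i\<in>UNIV. x $ i) = 1"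
  shows "diag_of x \<in> C"
  using assms
\<comment> \<open>\<open>Suc\<close> gives level 0 a positive weight, so the measure drops whenever
  the support shrinks, even if only level 0 is lost; moving a population down into a gap lowers it
  as well.\<close>
proof (induction "\<Sum>i | x $ i \<noteq> 0. Suc (pos i)" arbitrary: x rule: less_induct)
  case less
  obtain i0 where i0: "pos i0 = 0" using pos_surj[of 0] by auto
  show ?case
  proof (cases "\<exists>i j. pos i < pos j \<and> x $ i = 0 \<and> x $ j \<noteq> 0")
    case True
    then obtain i j where ij: "pos i < pos j" "x $ i = 0" "x $ j \<noteq> 0" by blast
    then have "i \<noteq> j" by auto
    define y where "y = (\<chi> k. x $ Transposition.transpose i j k)"
    have supp: "{k. y $ k \<noteq> 0} = insert i ({k. x $ k \<noteq> 0} - {j})"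
      using ij by (auto simp: y_def Transposition.transpose_def split: if_splits)
    have "(\<Sum>k | y $ k \<noteq> 0. Suc (pos k)) < (\<Sum>k | x $ k \<noteq> 0. Suc (pos k))"
      unfolding supp using ij by (subst (2) sum.remove[of _ j]) (auto simp: sum.insert_if)
    moreover have "(\<Sum>k\<in>UNIV. y $ k) = 1"
      unfolding y_def using less.prems(2)
        sum.reindex[of "Transposition.transpose i j" UNIV "\<lambda>k. x $ k"] by simp
    ultimately have "diag_of y \<in> C"
      using less.prems(1) by (intro less.hyps) (auto simp: y_def)
    then have "flow (ad (skew_pair i j 1)) (pi / 2) (diag_of y) \<in> C"
      using skew_pair_mem_su[OF \<open>i \<noteq> j\<close>] by (rule ad_C[rotated])
    moreover have "(\<chi> k. y $ Transposition.transpose i j k) = x"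
      by (simp add: vec_eq_iff y_def)
    ultimately show ?thesis by (simp add: flow_swap[OF \<open>i \<noteq> j\<close>])
  next
    case sorted: False
    then have down: "x $ i \<noteq> 0" if "pos i \<le> pos j" "x $ j \<noteq> 0" for i j
      using that inj_pos by (metis injD order.order_iff_strict)
    show ?thesis
    proof (cases "\<forall>i. i \<noteq> i0 \<longrightarrow> x $ i = 0")
      case True
      then have "(\<Sum>i\<in>UNIV. x $ i) = (\<Sum>i\<in>UNIV. if i = i0 then x $ i0 else 0)"
        by (intro sum.cong) auto
      then have "x = axis i0 1"
        using less.prems(2) True by (auto simp: vec_eq_iff axis_def)
      then show ?thesis using ground_state_mem[OF i0] by simp
    next
      case False
      then obtain j where j: "j \<noteq> i0" "x $ j \<noteq> 0" by blast
      then have "0 < pos j" using i0 inj_pos by (metis gr0I injD)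
      then obtain i1 where i1: "pos i1 = 1"
        using pos_surj[of 1] pos_less[of j] by auto
      then have excited: "x $ i1 \<noteq> 0" using down[of i1 j] j \<open>0 < pos j\<close> by simp
      show ?thesis
      proof (rule backward_decay[of x i1])
        show "x $ i \<noteq> 0" if "pos i \<le> pos j" "x $ j \<noteq> 0" for i j
          using that by (rule down)
        show "x $ i1 \<noteq> 0" by (rule excited)
        fix t z
        assume tz: "0 \<le> t" "diag_of x = flow L t (diag_of z)" "\<And>i. 0 \<le> z $ i"
          "(\<Sum>i\<in>UNIV. z $ i) = 1" "{i. z $ i \<noteq> 0} \<subset> {i. x $ i \<noteq> 0}"
        have "(\<Sum>i | z $ i \<noteq> 0. Suc (pos i)) < (\<Sum>i | x $ i \<noteq> 0. Suc (pos i))"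
          using tz(5) by (auto intro!: sum_strict_mono2)
        then have "diag_of z \<in> C" using tz by (intro less.hyps) auto
        then show "diag_of x \<in> C" using L_C tz by simp
      qed (use less.prems i1 in auto)
    qed
  qed
qed

text \<open>The flow is an isometry mapping \<open>C\<close> into itself, so a nearest point is
  carried along. Applied to the reverse flow this yields equality, and the level sets of the
  distance become invariant under the unitary flows.\<close>

lemma infdist_flow_ad_le:
  assumes A: "A \<in> su"
  shows "infdist (flow (ad A) t X) C \<le> infdist X C"
proof -
  obtain Y where Y: "Y \<in> C" "infdist X C = dist X Y"
    using infdist_attains_inf[OF C(1,2)] by metis
  have "infdist (flow (ad A) t X) C \<le> dist (flow (ad A) t X) (flow (ad A) t Y)"
    using A Y by (intro infdist_le ad_C)
  also have "\<dots> = dist X Y"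
    using A by (simp add: dist_norm norm_flow_ad suD flip: linear_diff[OF linear_flow])
  finally show ?thesis using Y by simp
qed

lemma infdist_flow_ad: "A \<in> su \<Longrightarrow> infdist (flow (ad A) t X) C = infdist X C"
  using infdist_flow_ad_le[of A t X] infdist_flow_ad_le[of A "- t" "flow (ad A) t X"] by simp

theorem C_eq: "C = density_matrices"
proof
  show "C \<subseteq> density_matrices" by (rule C)
  show "density_matrices \<subseteq> C"
  proof
    fix \<sigma> :: "'d cmatrix" assume \<sigma>: "\<sigma> \<in> density_matrices"
    define W where "W = {X \<in> density_matrices. infdist X C = infdist \<sigma> C}"
    have "closed {X. infdist X C = infdist \<sigma> C}"
      by (intro closed_Collect_eq continuous_intros)
    then have compact: "compact W"
      unfolding W_def Collect_conj_eq
      using compact_Int_closed[OF compact_density_matrices] by simp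
    have inv: "flow (ad A) t X \<in> W" if A: "A \<in> su" and X: "X \<in> W" for A t X
    proof -
      have "flow (ad A) t X \<in> density_matrices"
        using X flow_ad_density[OF suD[OF A]] by (simp add: W_def)
      then show ?thesis using X infdist_flow_ad[OF A] by (simp add: W_def)
    qed
    have "W \<noteq> {}" "W \<subseteq> density_matrices" using \<sigma> by (auto simp: W_def)
    then obtain x where "diag_of x \<in> W"
      by (rule energy_minimizer[OF compact _ _ inv inj_pos])
    then have x: "diag_of x \<in> density_matrices" "infdist (diag_of x) C = infdist \<sigma> C"
      by (auto simp: W_def)
    then have "diag_of x \<in> C"
      using diag_of_mem_density_iff[of x] diag_density_mem by blast
    then have "infdist \<sigma> C = 0" using x(2) by simp
    then show "\<sigma> \<in> C"
      using in_closed_iff_infdist_zero[OF C(1,2)] by blast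
  qed
qed

end

section \<open>The ladder operators\<close>

definition ladder :: "('d \<Rightarrow> nat) \<Rightarrow> (nat \<Rightarrow> real) \<Rightarrow> 'd::finite cmatrix" where
  "ladder pos c = (\<chi> i j. if pos j = Suc (pos i) then of_real (c (pos j)) else 0)"

text \<open>Indexed by the column, counted from 0: the entry of \<open>sigma_plus\<close> leading
  from level k to level k - 1 is sqrt (k (n - k)). Reduction mod n repeats it in every block and
  gives 0 at multiples of n, so both dissipators become single ladders.\<close>

definition ladder_coeff :: "nat \<Rightarrow> nat \<Rightarrow> real" where
  "ladder_coeff n q = sqrt (real (q mod n * (n - q mod n)))"

lemma sigma_plus_eq:
  assumes "b < n"
  shows "sigma_plus n a b = (if b = Suc a then of_real (ladder_coeff n b) else 0)"
proof -
  have "sigma_plus n a b =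
      (\<Sum>k=1..n-1. if k = Suc a then (if b = Suc a then of_real (sqrt (real (b * (n - b)))) else 0) else 0)"
    unfolding sigma_plus_def by (rule sum.cong) (auto simp: unit_entries_def simp del: of_nat_mult)
  also have "\<dots> = (if b = Suc a then of_real (ladder_coeff n b) else 0)"
    using assms by (auto simp: ladder_coeff_def simp del: of_nat_mult)
  finally show ?thesis .
qed

text \<open>Consecutive positions a and b = a + 1 lie in different blocks exactly when n divides b;
  the Kronecker entry is then 0, in agreement with the vanishing coefficient.\<close>

lemma kronecker_sigma_plus_eq:
  assumes "a < p * n" "b < p * n"
  shows "kronecker n (identity_entries p) (sigma_plus n) a b
    = (if b = Suc a then of_real (ladder_coeff n b) else 0)"
proof -
  have n: "0 < n" using assms by (cases n) auto
  have "a div n < p" using assms(1) by (simp add: less_mult_imp_div_less)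
  moreover have "b mod n < n" using n by simp
  moreover have "ladder_coeff n (b mod n) = ladder_coeff n b" by (simp add: ladder_coeff_def)
  ultimately have eq: "kronecker n (identity_entries p) (sigma_plus n) a b
    = (if a div n = b div n \<and> b mod n = Suc (a mod n) then of_real (ladder_coeff n b) else 0)"
    by (auto simp: kronecker_def identity_entries_def sigma_plus_eq)
  show ?thesis
  proof (cases "b = Suc a \<and> b mod n \<noteq> 0")
    case True
    then have "Suc (a mod n) \<noteq> n" by (auto simp: mod_Suc)
    with True have "a div n = b div n \<and> b mod n = Suc (a mod n)"
      by (simp add: mod_Suc div_Suc)
    then show ?thesis unfolding eq using True by simp
  next
    case False
    have "b = Suc a \<and> b mod n \<noteq> 0" if "a div n = b div n" "b mod n = Suc (a mod n)"
      using that by (metis add_Suc_right div_mult_mod_eq nat.distinct(1))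
    then have "\<not> (a div n = b div n \<and> b mod n = Suc (a mod n))" using False by blast
    moreover have "ladder_coeff n b = 0" if "b = Suc a"
      using False that by (simp add: ladder_coeff_def)
    ultimately show ?thesis unfolding eq by (metis of_real_0)
  qed
qed

lemma gksl_ladder:
  fixes pos :: "'d::finite \<Rightarrow> nat"
  assumes bij: "bij_betw pos UNIV {..<CARD('d)}"
    and \<Gamma>: "gksl_\<Gamma>\<^sub>0 pos \<Gamma> \<or> gksl_\<Gamma>\<^sub>0_loc pos \<Gamma>"
  obtains n where "1 < CARD('d) \<Longrightarrow> 1 < n" "\<Gamma> = gksl (ladder pos (ladder_coeff n))"
proof -
  have pos: "pos i < CARD('d)" for i using bij by (auto simp: bij_betw_def)
  from \<Gamma> show ?thesis
  proof
    assume "gksl_\<Gamma>\<^sub>0 pos \<Gamma>"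
    then have "\<Gamma> = gksl (matrix_of_entries pos (sigma_plus CARD('d)))"
      by (simp add: gksl_\<Gamma>\<^sub>0_def)
    moreover have "matrix_of_entries pos (sigma_plus CARD('d)) = ladder pos (ladder_coeff CARD('d))"
      by (simp add: vec_eq_iff matrix_of_entries_def ladder_def sigma_plus_eq pos)
    ultimately show ?thesis using that by simp
  next
    assume "gksl_\<Gamma>\<^sub>0_loc pos \<Gamma>"
    then obtain n m where nm: "1 \<le> n" "1 \<le> m" "CARD('d) = n ^ m"
      and \<Gamma>: "\<Gamma> = gksl (matrix_of_entries pos (kronecker n (identity_entries (n ^ (m - 1))) (sigma_plus n)))"
      by (auto simp: gksl_\<Gamma>\<^sub>0_loc_def)
    have "CARD('d) = n ^ (m - 1) * n"
      using nm by (simp add: power_eq_if)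
    then have "matrix_of_entries pos (kronecker n (identity_entries (n ^ (m - 1))) (sigma_plus n))
        = ladder pos (ladder_coeff n)"
      using pos by (simp add: vec_eq_iff matrix_of_entries_def ladder_def kronecker_sigma_plus_eq)
    moreover have "1 < n" if "1 < CARD('d)"
      using that nm by (cases "n = 1") auto
    ultimately show ?thesis using \<Gamma> by (intro that[of n]) auto
  qed
qed

text \<open>Rows and columns of the ladder have at most one nonzero entry, so all products stay
  diagonal. Column 0 is empty, which matches \<open>c 0 = 0\<close>.\<close>

lemma gksl_ladder_diag_of:
  fixes pos :: "'d::finite \<Rightarrow> nat"
  assumes bij: "bij_betw pos UNIV {..<CARD('d)}" and c0: "c 0 = 0"
  shows "gksl (ladder pos c) (diag_of x) = diag_of (\<chi> i. (c (pos i))\<^sup>2 * x $ i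
    - (\<Sum>k\<in>UNIV. if pos k = Suc (pos i) then (c (pos k))\<^sup>2 * x $ k else 0))"
proof -
  let ?V = "ladder pos c"
  have inj: "pos i = pos j \<longleftrightarrow> i = j" for i j
    using bij by (auto simp: bij_betw_def dest: injD)
  have VV: "dagger ?V ** ?V = diag_of (\<chi> i. (c (pos i))\<^sup>2)"
  proof -
    have "(dagger ?V ** ?V) $ i $ j = diag_of (\<chi> i. (c (pos i))\<^sup>2) $ i $ j" for i j
    proof (cases "i = j \<and> pos i \<noteq> 0")
      case True
      then obtain q where q: "pos i = Suc q" by (cases "pos i") auto
      have "q < CARD('d)" using bij q by (metis Suc_lessD UNIV_I bij_betwE lessThan_iff)
      then obtain p where "pos p = q" using bij by (metis bij_betw_def imageE lessThan_iff)
      then have p: "pos i = Suc (pos k) \<longleftrightarrow> k = p" for k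
        using q inj[of k p] by auto
      have ij: "j = i" using True by simp
      have "(dagger ?V ** ?V) $ i $ j = (\<Sum>k\<in>UNIV. if k = p then of_real ((c (pos i))\<^sup>2) else 0)"
        unfolding matrix_mult_nth
        by (intro sum.cong) (auto simp: ladder_def p ij power2_eq_square)
      then show ?thesis using True by simp
    next
      case False
      then show ?thesis
        unfolding matrix_mult_nth by (auto simp: ladder_def c0 inj intro!: sum.neutral) (metis inj)
    qed
    then show ?thesis by (simp add: vec_eq_iff)
  qed
  have dd: "diag_of v ** diag_of w = diag_of (\<chi> i. v $ i * w $ i)" for v w :: "real^'d"
  proof -
    have "(diag_of v ** diag_of w) $ i $ j = (\<Sum>k\<in>UNIV. if k = i then (if i = j then of_real (v $ i * w $ i) else 0) else 0)"
      for i j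
      unfolding matrix_mult_nth by (rule sum.cong) auto
    then show ?thesis by (simp add: vec_eq_iff)
  qed
  have VxV: "?V ** diag_of x ** dagger ?V =
      diag_of (\<chi> i. \<Sum>k\<in>UNIV. if pos k = Suc (pos i) then (c (pos k))\<^sup>2 * x $ k else 0)"
  proof -
    have Vx: "(?V ** diag_of x) $ i $ k = (if pos k = Suc (pos i) then of_real (c (pos k) * x $ k) else 0)" for i k
    proof -
      have "(?V ** diag_of x) $ i $ k
        = (\<Sum>l\<in>UNIV. if l = k then (if pos k = Suc (pos i) then of_real (c (pos k) * x $ k) else 0) else 0)"
        unfolding matrix_mult_nth by (rule sum.cong) (auto simp: ladder_def)
      then show ?thesis by simp
    qed
    have "(?V ** diag_of x ** dagger ?V) $ i $ j
      = (\<Sum>k\<in>UNIV. if i = j \<and> pos k = Suc (pos i) then of_real ((c (pos k))\<^sup>2 * x $ k) else 0)" for i j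
      unfolding matrix_mult_nth[of "?V ** diag_of x"] Vx
      by (rule sum.cong) (auto simp: ladder_def inj power2_eq_square)
    then show ?thesis
      by (auto simp: vec_eq_iff if_distrib[of of_real] intro!: sum.cong)
  qed
  have "dagger ?V ** ?V ** diag_of x = diag_of (\<chi> i. (c (pos i))\<^sup>2 * x $ i)"
    unfolding VV dd by simp
  moreover have "diag_of x ** dagger ?V ** ?V = diag_of (\<chi> i. (c (pos i))\<^sup>2 * x $ i)"
    unfolding matrix_mul_assoc[symmetric] VV dd by (simp add: mult.commute)
  ultimately show ?thesis
    unfolding gksl_def VxV by (simp add: vec_eq_iff complex_eq_iff)
qed

section \<open>The control system\<close>

text \<open>The rate enters the jump operator as sqrt v and the anticommutator as v/2, so every
  nonnegative rate yields a trace-preserving Lindblad form when A is hermitian.\<close>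

definition control_generator :: "'d cmatrix \<Rightarrow> real \<Rightarrow> 'd cmatrix \<Rightarrow> 'd::finite cmatrix endo" where
  "control_generator A v V =
     lindblad (cscale (- \<i>) A - (v / 2) *\<^sub>R (dagger V ** V)) (sqrt v *\<^sub>R V)"

lemma dagger_diff: "dagger (A - B) = dagger A - dagger B"
  by (simp add: vec_eq_iff)

lemma control_generator_apply:
  assumes "hermitian A" "0 \<le> v"
  shows "endo_apply (control_generator A v V) X = cscale (- \<i>) (commutator A X) - v *\<^sub>R gksl V X"
proof -
  have "sqrt v *\<^sub>R V ** X ** dagger (sqrt v *\<^sub>R V) = v *\<^sub>R (V ** X ** dagger V)"
    using assms(2) by (simp add: dagger_scaleR cmatrix_algebra)
  moreover have "cscale (- \<i>) (commutator A X) = cscale (- \<i>) A ** X + X ** cscale \<i> A"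
    by (simp add: commutator_def cscale_mult_left cscale_mult_right vec_eq_iff algebra_simps)
  moreover have "dagger (cscale (- \<i>) A) = cscale \<i> A"
    using assms(1) by (simp add: hermitian_def dagger_cscale)
  ultimately show ?thesis
    by (simp add: control_generator_def lindblad_apply gksl_def dagger_diff dagger_scaleR dagger_mult
        cmatrix_algebra scaleR_right_distrib scaleR_right_diff_distrib)
qed

lemma control_generator_balance:
  fixes A V :: "'d::finite cmatrix"
  assumes "hermitian A" "0 \<le> v"
  defines "K \<equiv> cscale (- \<i>) A - (v / 2) *\<^sub>R (dagger V ** V)" and "W \<equiv> sqrt v *\<^sub>R V"
  shows "K + dagger K + dagger W ** W = 0"
proof -
  have "dagger K = cscale \<i> A - (v / 2) *\<^sub>R (dagger V ** V)"
    using assms(1) by (simp add: K_def dagger_diff dagger_scaleR dagger_mult dagger_cscale hermitian_def)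
  moreover have "dagger W ** W = v *\<^sub>R (dagger V ** V)"
    using assms(2) by (simp add: W_def dagger_scaleR cmatrix_algebra)
  moreover have "v *\<^sub>R M = (v / 2) *\<^sub>R M + (v / 2) *\<^sub>R M" for M :: "'d cmatrix"
    by (simp flip: scaleR_left_distrib)
  ultimately show ?thesis
    by (simp add: K_def vec_eq_iff)
qed

lemma flow_control_generator_density:
  "hermitian A \<Longrightarrow> 0 \<le> v \<Longrightarrow> X \<in> density_matrices \<Longrightarrow> 0 \<le> t \<Longrightarrow>
    flow (control_generator A v V) t X \<in> density_matrices"
  unfolding control_generator_def
  by (intro flow_lindblad_density control_generator_balance)

lemma trace_flow_control_generator:
  "hermitian A \<Longrightarrow> 0 \<le> v \<Longrightarrow> trace (flow (control_generator A v V) t X) = trace X"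
  unfolding control_generator_def
  by (intro trace_flow_lindblad control_generator_balance)

definition hamiltonian :: "nat \<Rightarrow> (nat \<Rightarrow> 'd cmatrix) \<Rightarrow> (nat \<Rightarrow> real) \<Rightarrow> 'd::finite cmatrix" where
  "hamiltonian r H w = H 0 + (\<Sum>j=1..r. w j *\<^sub>R H j)"

lemma dagger_sum: "dagger (\<Sum>i\<in>I. f i) = (\<Sum>i\<in>I. dagger (f i))"
  by (simp add: vec_eq_iff)

lemma hermitian_hamiltonian:
  assumes "\<And>j. j \<le> r \<Longrightarrow> hermitian (H j)"
  shows "hermitian (hamiltonian r H w)"
  using assms by (simp add: hermitian_def hamiltonian_def dagger_add dagger_sum dagger_scaleR)

lemma control_field_eq:
  assumes "\<And>j. j \<le> r \<Longrightarrow> hermitian (H j)" "0 \<le> \<gamma> t"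
  shows "control_field r H (gksl V) u \<gamma> t X
    = endo_apply (control_generator (hamiltonian r H (\<lambda>j. u j t)) (\<gamma> t) V) X"
  using assms by (simp add: control_generator_apply hermitian_hamiltonian)
    (simp add: control_field_def hamiltonian_def)

lemma piecewise_constant_switch:
  assumes "piecewise_constant u"
  shows "piecewise_constant (\<lambda>\<tau>. if \<tau> < t then u \<tau> else v)"
  unfolding piecewise_constant_def
proof (intro allI impI)
  fix T :: real assume "0 \<le> T"
  then obtain D where D: "finite D"
    "\<And>s s'. 0 \<le> s \<Longrightarrow> s \<le> s' \<Longrightarrow> s' \<le> T \<Longrightarrow> {s..s'} \<inter> D = {} \<Longrightarrow> u s = u s'"
    using assms unfolding piecewise_constant_def by meson
  show "\<exists>D. finite D \<and> (\<forall>s s'. 0 \<le> s \<and> s \<le> s' \<and> s' \<le> T \<and> {s..s'} \<inter> D = {} \<longrightarrow>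
      (if s < t then u s else v) = (if s' < t then u s' else v))"
    using D by (intro exI[of _ "insert t D"]) auto
qed

lemma reachI:
  assumes "is_solution (control_field r H \<Gamma> u \<gamma>) \<rho>\<^sub>0 \<rho>" "\<gamma> \<in> G"
    "\<And>j. j \<in> {1..r} \<Longrightarrow> piecewise_constant (u j)" "0 \<le> t"
  shows "\<rho> t \<in> reach r H \<Gamma> G \<rho>\<^sub>0"
  unfolding reach_def using assms by blast

text \<open>The common ground of both assumptions. Which constant rates may be appended to a
  switching function is left to the hypotheses of the individual lemmas.\<close>

locale control_system =
  fixes r :: nat and H :: "nat \<Rightarrow> 'd::finite cmatrix" and V :: "'d cmatrix"
    and G :: "(real \<Rightarrow> real) set" and \<rho>\<^sub>0 :: "'d cmatrix"
  assumes herm: "\<And>j. j \<le> r \<Longrightarrow> hermitian (H j)"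
    and G: "\<gamma> \<in> G \<Longrightarrow> piecewise_constant \<gamma> \<and> (\<forall>t\<ge>0. 0 \<le> \<gamma> t)"
    and \<rho>\<^sub>0: "\<rho>\<^sub>0 \<in> density_matrices"
begin

abbreviation generator :: "(nat \<Rightarrow> real) \<Rightarrow> real \<Rightarrow> 'd cmatrix endo" where
  "generator w v \<equiv> control_generator (hamiltonian r H w) v V"

abbreviation R :: "'d cmatrix set" where
  "R \<equiv> reach r H (gksl V) G \<rho>\<^sub>0"

lemma reach_subset_density: "R \<subseteq> density_matrices"
proof
  fix X assume "X \<in> R"
  then obtain \<rho> t u \<gamma> where X: "X = \<rho> t" "0 \<le> t"
    and u: "\<And>j. j \<in> {1..r} \<Longrightarrow> piecewise_constant (u j)" and \<gamma>: "\<gamma> \<in> G"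
    and \<rho>: "is_solution (control_field r H (gksl V) u \<gamma>) \<rho>\<^sub>0 \<rho>"
    unfolding reach_def by blast
  have "\<exists>D. \<forall>j\<in>{1..r}. finite (D j) \<and>
      (\<forall>s s'. 0 \<le> s \<and> s \<le> s' \<and> s' \<le> t \<and> {s..s'} \<inter> D j = {} \<longrightarrow> u j s = u j s')"
    using u X(2) unfolding piecewise_constant_def by (intro bchoice) blast
  then obtain D where D: "\<And>j. j \<in> {1..r} \<Longrightarrow> finite (D j)"
    "\<And>j s s'. j \<in> {1..r} \<Longrightarrow> 0 \<le> s \<Longrightarrow> s \<le> s' \<Longrightarrow> s' \<le> t \<Longrightarrow> {s..s'} \<inter> D j = {} \<Longrightarrow> u j s = u j s'"
    by metis
  obtain D\<gamma> where D\<gamma>: "finite D\<gamma>"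
    "\<And>s s'. 0 \<le> s \<Longrightarrow> s \<le> s' \<Longrightarrow> s' \<le> t \<Longrightarrow> {s..s'} \<inter> D\<gamma> = {} \<Longrightarrow> \<gamma> s = \<gamma> s'"
    using G[OF \<gamma>] X(2) unfolding piecewise_constant_def by metis
  obtain D' where D': "finite D'" "\<And>s. 0 < s \<Longrightarrow> s < t \<Longrightarrow> s \<notin> D' \<Longrightarrow>
      (\<rho> has_vector_derivative control_field r H (gksl V) u \<gamma> s (\<rho> s)) (at s)"
    using \<rho> X(2) unfolding is_solution_def by metis
  define E where "E = (\<Union>j\<in>{1..r}. D j) \<union> D\<gamma> \<union> D'"
  have "\<rho> t \<in> density_matrices"
  proof (rule finite_partition_induct[where D = E and s = 0 and t = t and P = "\<lambda>s. \<rho> s \<in> density_matrices"])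
    show "finite E" using D(1) D\<gamma>(1) D'(1) by (simp add: E_def)
    show "\<rho> 0 \<in> density_matrices" using \<rho> \<rho>\<^sub>0 by (simp add: is_solution_def)
    fix a b :: real
    assume ab: "0 \<le> a" "a < b" "b \<le> t" "{a<..<b} \<inter> E = {}" and a: "\<rho> a \<in> density_matrices"
    \<comment> \<open>On an open interval without switching points all controls equal their values
      at the midpoint, so the solution is a linear flow there; the values at the endpoints may be
      arbitrary.\<close>
    define m where "m = (a + b) / 2"
    have m: "a < m" "m < b" using ab by (simp_all add: m_def)
    have const: "f s = f m" if s: "a < s" "s < b"
      and f: "\<And>s s'. 0 \<le> s \<Longrightarrow> s \<le> s' \<Longrightarrow> s' \<le> t \<Longrightarrow> {s..s'} \<inter> F = {} \<Longrightarrow> f s = f s'" and F: "F \<subseteq> E"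
      for f :: "real \<Rightarrow> real" and F s
    proof -
      have sub: "{p..q} \<inter> F = {}" if "a < p" "q < b" for p q
      proof -
        have "{p..q} \<subseteq> {a<..<b}" using that by auto
        then show ?thesis using ab(4) F by blast
      qed
      show ?thesis
      proof (cases "s \<le> m")
        case True
        then show ?thesis using s m ab by (intro f sub) auto
      next
        case False
        then have "f m = f s" using s m ab by (intro f sub) auto
        then show ?thesis by simp
      qed
    qed
    let ?L = "generator (\<lambda>j. u j m) (\<gamma> m)"
    have \<gamma>m: "0 \<le> \<gamma> m" using G[OF \<gamma>] m ab by simp
    have deriv: "(\<rho> has_vector_derivative endo_apply ?L (\<rho> s)) (at s)" if s: "a < s" "s < b" for s
    proof -
      have "u j s = u j m" if "j \<in> {1..r}" for j
        using that by (intro const[OF s, where F = "D j"] D(2)) (auto simp: E_def)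
      then have "hamiltonian r H (\<lambda>j. u j s) = hamiltonian r H (\<lambda>j. u j m)"
        by (simp add: hamiltonian_def)
      moreover have "\<gamma> s = \<gamma> m"
        by (intro const[OF s, where F = "D\<gamma>"] D\<gamma>(2)) (auto simp: E_def)
      moreover have "s \<notin> D'" using s ab by (auto simp: E_def)
      ultimately show ?thesis
        using D'(2)[of s] s ab \<gamma>m herm by (simp add: control_field_eq)
    qed
    have "continuous_on {a..b} \<rho>"
      using \<rho> ab unfolding is_solution_def by (auto elim: continuous_on_subset)
    then have "\<rho> b = flow ?L (b - a) (\<rho> a)"
      using ab deriv by (intro flow_unique[where K = "{}"]) auto
    then show "\<rho> b \<in> density_matrices"
      using a ab \<gamma>m herm by (simp add: flow_control_generator_density hermitian_hamiltonian)
  qed (use X in auto)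
  then show "X \<in> density_matrices" using X by simp
qed

lemma start_mem_reach:
  assumes "(\<lambda>_. v) \<in> G"
  shows "\<rho>\<^sub>0 \<in> R"
proof -
  have v: "0 \<le> v" using G[OF assms] by auto
  have "is_solution (control_field r H (gksl V) (\<lambda>_ _. 0) (\<lambda>_. v)) \<rho>\<^sub>0 (\<lambda>t. flow (generator (\<lambda>_. 0) v) t \<rho>\<^sub>0)"
    unfolding is_solution_def
    by (intro conjI allI impI exI[of _ "{}"])
       (simp_all add: control_field_eq herm v continuous_on_flow flow_has_vector_derivative)
  then have "flow (generator (\<lambda>_. 0) v) 0 \<rho>\<^sub>0 \<in> R"
    using assms by (rule reachI) (auto simp: piecewise_constant_def)
  then show ?thesis by simp
qed

text \<open>Concatenation: the given trajectory is followed up to t, then the constants w and v act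
  for time s. The derivative may fail at t, so t joins the exceptional set.\<close>

lemma flow_mem_reach:
  assumes X: "X \<in> R" and s: "0 \<le> s" and v: "0 \<le> v"
    and switch: "\<And>\<gamma> t. \<gamma> \<in> G \<Longrightarrow> 0 \<le> t \<Longrightarrow> (\<lambda>\<tau>. if \<tau> < t then \<gamma> \<tau> else v) \<in> G"
  shows "flow (generator w v) s X \<in> R"
proof -
  obtain \<rho> t u \<gamma> where X: "X = \<rho> t" "0 \<le> t"
    and u: "\<And>j. j \<in> {1..r} \<Longrightarrow> piecewise_constant (u j)" and \<gamma>: "\<gamma> \<in> G"
    and \<rho>: "is_solution (control_field r H (gksl V) u \<gamma>) \<rho>\<^sub>0 \<rho>"
    using X unfolding reach_def by blast
  define u' where "u' j \<tau> = (if \<tau> < t then u j \<tau> else w j)" for j \<tau>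
  define \<gamma>' where "\<gamma>' \<tau> = (if \<tau> < t then \<gamma> \<tau> else v)" for \<tau>
  define y where "y \<tau> = flow (generator w v) (\<tau> - t) (\<rho> t)" for \<tau>
  define \<rho>' where "\<rho>' \<tau> = (if \<tau> \<le> t then \<rho> \<tau> else y \<tau>)" for \<tau>
  have y: "(y has_vector_derivative endo_apply (generator w v) (y \<tau>)) (at \<tau> within A)" for \<tau> A
  proof -
    have "((\<lambda>\<tau>. \<tau> - t) has_vector_derivative 1) (at \<tau> within A)"
      by (auto intro!: derivative_eq_intros)
    then have "(((\<lambda>t'. flow (generator w v) t' (\<rho> t)) \<circ> (\<lambda>\<tau>. \<tau> - t)) has_vector_derivative
        1 *\<^sub>R endo_apply (generator w v) (flow (generator w v) (\<tau> - t) (\<rho> t))) (at \<tau> within A)"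
      by (rule vector_diff_chain_within) (rule flow_has_vector_derivative)
    then show ?thesis by (simp add: o_def y_def[abs_def])
  qed
  have "is_solution (control_field r H (gksl V) u' \<gamma>') \<rho>\<^sub>0 \<rho>'"
    unfolding is_solution_def
  proof (intro conjI allI impI)
    show "\<rho>' 0 = \<rho>\<^sub>0" using \<rho> X by (simp add: \<rho>'_def is_solution_def)
    have "continuous_on ({0..t} \<union> {t..}) \<rho>'"
      unfolding \<rho>'_def
    proof (rule continuous_on_If)
      show "continuous_on {0..t} \<rho>" using \<rho> by (auto simp: is_solution_def elim: continuous_on_subset)
      show "continuous_on {t..} y" by (rule continuous_on_vector_derivative) (rule y)
    qed (auto simp: y_def)
    moreover have "{0..t} \<union> {t..} = {0..}" using X by auto
    ultimately show "continuous_on {0..} \<rho>'" by simp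
  next
    fix T :: real assume "0 \<le> T"
    then obtain D where D: "finite D" "\<And>\<tau>. 0 < \<tau> \<Longrightarrow> \<tau> < T \<Longrightarrow> \<tau> \<notin> D \<Longrightarrow>
        (\<rho> has_vector_derivative control_field r H (gksl V) u \<gamma> \<tau> (\<rho> \<tau>)) (at \<tau>)"
      using \<rho> unfolding is_solution_def by metis
    have "(\<rho>' has_vector_derivative control_field r H (gksl V) u' \<gamma>' \<tau> (\<rho>' \<tau>)) (at \<tau>)"
      if \<tau>: "0 < \<tau>" "\<tau> < T" "\<tau> \<notin> insert t D" for \<tau>
    proof (cases "\<tau> < t")
      case True
      have "(\<rho> has_vector_derivative control_field r H (gksl V) u \<gamma> \<tau> (\<rho> \<tau>)) (at \<tau>)"
        using D \<tau> by auto
      then have "(\<rho>' has_vector_derivative control_field r H (gksl V) u \<gamma> \<tau> (\<rho> \<tau>)) (at \<tau>)"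
        by (rule has_vector_derivative_transform_within_open[where S = "{..<t}"])
           (use True in \<open>auto simp: \<rho>'_def\<close>)
      then show ?thesis using True by (simp add: control_field_def u'_def \<gamma>'_def \<rho>'_def)
    next
      case False
      then have "t < \<tau>" using \<tau> by simp
      have "(y has_vector_derivative endo_apply (generator w v) (y \<tau>)) (at \<tau>)" by (rule y)
      then have "(\<rho>' has_vector_derivative endo_apply (generator w v) (y \<tau>)) (at \<tau>)"
        by (rule has_vector_derivative_transform_within_open[where S = "{t<..}"])
           (use \<open>t < \<tau>\<close> in \<open>auto simp: \<rho>'_def\<close>)
      then show ?thesis
        using \<open>t < \<tau>\<close> v by (simp add: control_field_eq herm u'_def \<gamma>'_def \<rho>'_def)
    qed
    then show "\<exists>D. finite D \<and> (\<forall>\<tau>. 0 < \<tau> \<and> \<tau> < T \<and> \<tau> \<notin> D \<longrightarrow>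
        (\<rho>' has_vector_derivative control_field r H (gksl V) u' \<gamma>' \<tau> (\<rho>' \<tau>)) (at \<tau>))"
      using D(1) by (intro exI[of _ "insert t D"]) auto
  qed
  moreover have "\<gamma>' \<in> G" unfolding \<gamma>'_def using \<gamma> X(2) by (rule switch)
  moreover have "piecewise_constant (u' j)" if "j \<in> {1..r}" for j
    unfolding u'_def by (intro piecewise_constant_switch u that)
  ultimately have "\<rho>' (t + s) \<in> R"
    by (rule reachI) (use s X(2) in simp_all)
  moreover have "flow (generator w v) s X = \<rho>' (t + s)"
    using s X by (auto simp: \<rho>'_def y_def)
  ultimately show ?thesis by simp
qed

text \<open>Stability is tested pointwise against a closed set, so \<open>S\<close> is closed;
  limits of admissible controls therefore count as available operations.\<close>

definition S :: "'d cmatrix endo set" where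
  "S = {T. \<forall>X\<in>closure R. endo_apply T X \<in> closure R}"

sublocale closed_submonoid S
  by unfold_locales (auto simp: S_def intro: closed_endo_stable)

lemma exp_generator_mem:
  assumes "0 \<le> s" "0 \<le> v"
    and "\<And>\<gamma> t. \<gamma> \<in> G \<Longrightarrow> 0 \<le> t \<Longrightarrow> (\<lambda>\<tau>. if \<tau> < t then \<gamma> \<tau> else v) \<in> G"
  shows "exp (s *\<^sub>R generator w v) \<in> S"
proof -
  have "flow (generator w v) s ` closure R \<subseteq> closure R"
  proof (rule image_closure_subset)
    show "continuous_on (closure R) (flow (generator w v) s)"
      by (intro linear_continuous_on linear_flow[unfolded linear_conv_bounded_linear])
    show "flow (generator w v) s ` R \<subseteq> closure R"
      using flow_mem_reach[OF _ assms] closure_subset by blast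
  qed simp
  then show ?thesis by (auto simp: S_def flow_def)
qed

text \<open>\<open>ad\<close> is a homomorphism of Lie algebras, so the preimage of
  \<open>generators\<close> is a real Lie subalgebra and contains the hull once it contains the
  matrices indexed by \<open>J\<close>.\<close>

lemma su_generators:
  assumes lie: "lie_generated ((\<lambda>j. cscale \<i> (H j)) ` J) = su"
    and J: "\<And>j. j \<in> J \<Longrightarrow> ad (cscale \<i> (H j)) \<in> generators" and A: "A \<in> su"
  shows "ad A \<in> generators"
proof -
  have "real_lie_subalgebra {A. ad A \<in> generators}"
    unfolding real_lie_subalgebra_def
  proof (intro conjI ballI)
    show "subspace {A. ad A \<in> generators}"
      using linear_subspace_vimage[OF linear_ad subspace_generators] by (simp add: vimage_def)
  qed (simp add: ad_commutator generators_bracket)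
  then have "real_lie_subalgebra hull ((\<lambda>j. cscale \<i> (H j)) ` J) \<subseteq> {A. ad A \<in> generators}"
    using J by (intro hull_minimal) auto
  then show ?thesis using lie A by (auto simp: lie_generated_def)
qed

end

section \<open>Combining drift, controls and decay\<close>

lemma commutator_add_left: "commutator (A + B) X = commutator A X + commutator B X"
  by (simp add: commutator_def cmatrix_algebra)

lemma control_generator_add:
  assumes "hermitian A" "hermitian B" "0 \<le> v"
  shows "control_generator (A + B) v V = control_generator A v V + ad (cscale (- \<i>) B)"
proof (rule endo_eqI)
  have "hermitian (A + B)" using assms by (simp add: hermitian_def dagger_add)
  then show "endo_apply (control_generator (A + B) v V) X
      = endo_apply (control_generator A v V + ad (cscale (- \<i>) B)) X" for X
    using assms
    by (simp add: control_generator_apply commutator_add_left endo.add_left ad_apply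
        cscale_mult_left cscale_mult_right commutator_def[of B] vec_eq_iff algebra_simps)
qed

lemma control_generator_0:
  assumes "hermitian A"
  shows "control_generator A 0 V = ad (cscale (- \<i>) A)"
  by (rule endo_eqI)
     (simp add: assms control_generator_apply ad_apply commutator_def cscale_mult_left cscale_mult_right
        vec_eq_iff algebra_simps)

lemma dagger_cscale_hermitian: "hermitian A \<Longrightarrow> dagger (cscale (- \<i>) A) = - cscale (- \<i>) A"
  by (simp add: hermitian_def dagger_cscale vec_eq_iff)

context control_system
begin

lemma closure_reach_eq:
  assumes bij: "bij_betw pos UNIV {..<CARD('d)}" and H0: "diagonal_matrix (H 0)"
    and V: "V = ladder pos c" and c0: "c 0 = 0" and c1: "1 < CARD('d) \<Longrightarrow> c 1 \<noteq> 0"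
    and v: "0 < v" "(\<lambda>_. v) \<in> G"
    and switch: "\<And>\<gamma> t. \<gamma> \<in> G \<Longrightarrow> 0 \<le> t \<Longrightarrow> (\<lambda>\<tau>. if \<tau> < t then \<gamma> \<tau> else v) \<in> G"
    and ad: "\<And>A. A \<in> su \<Longrightarrow> ad A \<in> generators"
  shows "closure R = density_matrices"
proof -
  let ?L = "generator (\<lambda>_. 0) v"
  have ham0: "hamiltonian r H (\<lambda>_. 0) = H 0" by (simp add: hamiltonian_def)
  have herm0: "hermitian (H 0)" by (simp add: herm)
  have dens: "closure R \<subseteq> density_matrices"
    using reach_subset_density closed_density_matrices by (rule closure_minimal)
  have flow_S: "flow X t Y \<in> closure R" if "exp (t *\<^sub>R X) \<in> S" "Y \<in> closure R" for X t Y
    using that by (simp add: S_def flow_def)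
  have "decay pos c v ?L (closure R)"
  proof
    fix x
    \<comment> \<open>With all controls at zero a diagonal drift drops out on diagonal states, which
      leaves the death process with g = v.\<close>
    have "commutator (H 0) (diag_of x) = 0"
    proof -
      have "(H 0 ** diag_of x) $ i $ j = (\<Sum>k\<in>UNIV. if k = i then (if i = j then H 0 $ i $ i * of_real (x $ i) else 0) else 0)"
        for i j
        unfolding matrix_mult_nth using H0 by (intro sum.cong) (auto simp: diagonal_matrix_def)
      moreover have "(diag_of x ** H 0) $ i $ j = (\<Sum>k\<in>UNIV. if k = i then (if i = j then H 0 $ i $ i * of_real (x $ i) else 0) else 0)"
        for i j
        unfolding matrix_mult_nth using H0 by (intro sum.cong) (auto simp: diagonal_matrix_def)
      ultimately show ?thesis by (simp add: commutator_def vec_eq_iff)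
    qed
    then have "endo_apply ?L (diag_of x) = - v *\<^sub>R gksl V (diag_of x)"
      using v(1) by (simp add: ham0 control_generator_apply herm0 vec_eq_iff)
    then show "endo_apply ?L (diag_of x) = diag_of (\<chi> i. v * ((\<Sum>k\<in>UNIV.
        if pos k = Suc (pos i) then (c (pos k))\<^sup>2 * x $ k else 0) - (c (pos i))\<^sup>2 * x $ i))"
      unfolding V gksl_ladder_diag_of[where pos = pos and c = c, OF bij c0] by (simp add: vec_eq_iff complex_eq_iff algebra_simps)
  next
    show "trace (flow ?L t X) = trace X" for t X
      using v(1) by (simp add: ham0 trace_flow_control_generator herm0)
    show "closure R \<noteq> {}" using start_mem_reach[OF v(2)] by auto
    show "flow (ad A) t X \<in> closure R" if "A \<in> su" "X \<in> closure R" for A t X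
      using generatorsD[OF ad[OF that(1)]] that(2) by (rule flow_S)
    show "flow ?L t X \<in> closure R" if "0 \<le> t" "X \<in> closure R" for t X
      using exp_generator_mem[OF that(1) _ switch] v(1) that(2) by (intro flow_S) auto
  qed (use bij c0 c1 v dens in auto)
  then show ?thesis by (rule decay.C_eq)
qed

lemma hamiltonian_single:
  assumes "j \<in> {1..r}"
  shows "hamiltonian r H (\<lambda>k. if k = j then a else 0) = H 0 + a *\<^sub>R H j"
  using assms by (simp add: hamiltonian_def if_distrib[of "\<lambda>x. x *\<^sub>R _"] cong: if_cong)

text \<open>Without dissipation the drift can be run for negative times by recurrence.\<close>

lemma ad_mem_generators_switchable:
  assumes lie: "lie_generated ((\<lambda>j. cscale \<i> (H j)) ` {0..r}) = su"
    and off: "\<And>\<gamma> t. \<gamma> \<in> G \<Longrightarrow> 0 \<le> t \<Longrightarrow> (\<lambda>\<tau>. if \<tau> < t then \<gamma> \<tau> else 0) \<in> G"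
    and A: "A \<in> su"
  shows "ad A \<in> generators"
proof (rule su_generators[OF lie _ A])
  have ham: "ad (cscale (- \<i>) (hamiltonian r H w)) \<in> generators" for w
  proof -
    have herm_w: "hermitian (hamiltonian r H w)" by (simp add: hermitian_hamiltonian herm)
    have "exp (t *\<^sub>R ad (cscale (- \<i>) (hamiltonian r H w))) \<in> S" for t
    proof (rule exp_mem_of_bounded_orbit[where b = 1, OF closed])
      show "exp (s *\<^sub>R ad (cscale (- \<i>) (hamiltonian r H w))) \<in> S" if "0 \<le> s" for s
        using exp_generator_mem[OF that order_refl off, of w] by (simp add: control_generator_0 herm_w)
    qed (intro norm_exp_ad_le dagger_cscale_hermitian herm_w)
    then show ?thesis by (simp add: generators_def)
  qed
  fix j assume j: "j \<in> {0..r}"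
  show "ad (cscale \<i> (H j)) \<in> generators"
  proof (cases "j = 0")
    case True
    have "cscale \<i> (H j) = (- 1) *\<^sub>R cscale (- \<i>) (hamiltonian r H (\<lambda>_. 0))"
      by (simp add: True hamiltonian_def vec_eq_iff)
    then have "ad (cscale \<i> (H j)) = (- 1) *\<^sub>R ad (cscale (- \<i>) (hamiltonian r H (\<lambda>_. 0)))"
      by (simp only: linear_scale[OF linear_ad])
    then show ?thesis using generators_scaleR[OF ham] by metis
  next
    case False
    then have "j \<in> {1..r}" using j by auto
    \<comment> \<open>The drift is present in every available Hamiltonian; \<open>H j\<close> is
      isolated as a difference with and without unit control. The factor -i fixes the order of
      subtraction.\<close>
    then have "cscale \<i> (H j) = cscale (- \<i>) (hamiltonian r H (\<lambda>_. 0))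
        - cscale (- \<i>) (hamiltonian r H (\<lambda>k. if k = j then 1 else 0))"
      unfolding hamiltonian_single[OF \<open>j \<in> {1..r}\<close>] by (simp add: hamiltonian_def vec_eq_iff algebra_simps)
    then show ?thesis
      by (simp only: linear_diff[OF linear_ad]) (intro subspace_diff subspace_generators ham)
  qed
qed

text \<open>Strong controls acting for a short time make drift and dissipation negligible.\<close>

lemma ad_mem_generators_fast:
  assumes lie: "lie_generated ((\<lambda>j. cscale \<i> (H j)) ` {1..r}) = su" and v: "0 \<le> v"
    and switch: "\<And>\<gamma> t. \<gamma> \<in> G \<Longrightarrow> 0 \<le> t \<Longrightarrow> (\<lambda>\<tau>. if \<tau> < t then \<gamma> \<tau> else v) \<in> G"
    and A: "A \<in> su"
  shows "ad A \<in> generators"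
proof (rule su_generators[OF lie _ A])
  fix j assume j: "j \<in> {1..r}"
  have "exp (t *\<^sub>R ad (cscale \<i> (H j))) \<in> S" for t
  proof -
    define X where "X h = h *\<^sub>R control_generator (H 0) v V + t *\<^sub>R ad (cscale \<i> (H j))" for h
    have mem: "exp (X h) \<in> S" if h: "0 < h" for h
    proof -
      \<comment> \<open>A pulse of amplitude -t/h and duration h: the control contributes the fixed
        amount t i \<open>H j\<close>, while drift and dissipation carry the factor h.\<close>
      let ?w = "\<lambda>k. if k = j then - t / h else 0"
      have "hermitian (H 0)" "hermitian ((- t / h) *\<^sub>R H j)"
        using herm[of 0] herm[of j] j by (auto simp: hermitian_def dagger_scaleR dagger_minus)
      then have "generator ?w v = control_generator (H 0) v V + ad (cscale (- \<i>) ((- t / h) *\<^sub>R H j))"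
        unfolding hamiltonian_single[OF j] using v by (rule control_generator_add)
      also have "cscale (- \<i>) ((- t / h) *\<^sub>R H j) = (t / h) *\<^sub>R cscale \<i> (H j)"
        by (simp add: vec_eq_iff complex_eq_iff)
      finally have "h *\<^sub>R generator ?w v = X h"
        using h by (simp add: X_def linear_scale[OF linear_ad] scaleR_right_distrib)
      then show ?thesis
        using exp_generator_mem[OF less_imp_le[OF h] v switch, of ?w] by simp
    qed
    have "(\<lambda>n. X (inverse (real (Suc n)))) \<longlonglongrightarrow> X 0"
      unfolding X_def by (intro tendsto_intros LIMSEQ_inverse_real_of_nat)
    then have lim: "(\<lambda>n. exp (X (inverse (real (Suc n))))) \<longlonglongrightarrow> exp (X 0)"
      by (rule tendsto_exp_banach)
    have "exp (X 0) \<in> S"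
      by (rule closed_sequentially[OF closed _ lim]) (simp add: mem)
    then show ?thesis by (simp add: X_def)
  qed
  then show "ad (cscale \<i> (H j)) \<in> generators" by (simp add: generators_def)
qed

end

theorem corollary1:
  fixes pos :: "'d::finite \<Rightarrow> nat"
    and r :: nat
    and H :: "nat \<Rightarrow> 'd cmatrix"
    and \<Gamma> :: "'d cmatrix \<Rightarrow> 'd cmatrix"
    and G :: "(real \<Rightarrow> real) set"
    and \<rho>\<^sub>0 :: "'d cmatrix"
  assumes "bij_betw pos UNIV {..<CARD('d)}"
    and "\<And>j. j \<le> r \<Longrightarrow> hermitian (H j) \<and> trace (H j) = 0"
    and "diagonal_matrix (H 0)"
    and "gksl_\<Gamma>\<^sub>0 pos \<Gamma> \<or> gksl_\<Gamma>\<^sub>0_loc pos \<Gamma>"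
    and "assumption_UCS r H G \<or> assumption_FUC r H G"
    and "assumption_IN \<Gamma>"
    and "\<rho>\<^sub>0 \<in> density_matrices"
  shows "closure (reach r H \<Gamma> G \<rho>\<^sub>0) = density_matrices"
proof -
  obtain n where n: "1 < CARD('d) \<Longrightarrow> 1 < n" and \<Gamma>: "\<Gamma> = gksl (ladder pos (ladder_coeff n))"
    using gksl_ladder[OF assms(1,4)] by blast
  have c0: "ladder_coeff n 0 = 0" by (simp add: ladder_coeff_def)
  have c1: "ladder_coeff n 1 \<noteq> 0" if "1 < CARD('d)"
    using n[OF that] by (simp add: ladder_coeff_def)
  from assms(5) show ?thesis
  proof
    assume "assumption_UCS r H G"
    then have lie: "lie_generated ((\<lambda>j. cscale \<i> (H j)) ` {0..r}) = su"
      and G_eq: "G = {\<gamma>. piecewise_constant \<gamma> \<and> (\<forall>t\<ge>0. \<gamma> t \<in> {0, 1})}"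
      by (simp_all add: assumption_UCS_def)
    interpret control_system r H "ladder pos (ladder_coeff n)" G \<rho>\<^sub>0
      by unfold_locales (use assms G_eq in force)+
    \<comment> \<open>The value 0 serves the Lie algebra argument, the value 1 the decay.\<close>
    have switch: "(\<lambda>\<tau>. if \<tau> < t then \<gamma> \<tau> else v) \<in> G" if "\<gamma> \<in> G" "v \<in> {0, 1}" for \<gamma> t v
      using that by (auto simp: G_eq piecewise_constant_switch)
    show ?thesis
      unfolding \<Gamma>
    proof (rule closure_reach_eq[OF assms(1,3) refl c0 c1 zero_less_one])
      show "(\<lambda>_. 1) \<in> G" by (auto simp: G_eq piecewise_constant_def)
      show "ad A \<in> generators" if "A \<in> su" for A
        using lie _ that by (rule ad_mem_generators_switchable) (simp add: switch)
      show "(\<lambda>\<tau>. if \<tau> < t then \<gamma> \<tau> else 1) \<in> G" if "\<gamma> \<in> G" for \<gamma> t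
        using that by (rule switch) simp
    qed
  next
    assume "assumption_FUC r H G"
    then obtain v where lie: "lie_generated ((\<lambda>j. cscale \<i> (H j)) ` {1..r}) = su"
      and v: "0 < v" and G_eq: "G = {\<gamma>. \<forall>t\<ge>0. \<gamma> t = v}"
      by (auto simp: assumption_FUC_def)
    have "piecewise_constant \<gamma>" if "\<gamma> \<in> G" for \<gamma>
      using that by (auto simp: G_eq piecewise_constant_def)
    then interpret control_system r H "ladder pos (ladder_coeff n)" G \<rho>\<^sub>0
      by unfold_locales (use assms G_eq v in auto)
    \<comment> \<open>The single rate v has to serve both the fast pulses and the decay.\<close>
    have switch: "(\<lambda>\<tau>. if \<tau> < t then \<gamma> \<tau> else v) \<in> G" if "\<gamma> \<in> G" for \<gamma> t
      using that by (simp add: G_eq)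
    show ?thesis
      unfolding \<Gamma>
    proof (rule closure_reach_eq[OF assms(1,3) refl c0 c1 v])
      show "(\<lambda>_. v) \<in> G" by (simp add: G_eq)
      show "ad A \<in> generators" if "A \<in> su" for A
        using lie less_imp_le[OF v] _ that by (rule ad_mem_generators_fast) (simp add: switch)
      show "(\<lambda>\<tau>. if \<tau> < t then \<gamma> \<tau> else v) \<in> G" if "\<gamma> \<in> G" for \<gamma> t
        using that by (rule switch)
    qed
  qed
qed

end
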